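(* Suppose that $G$ is a finitely generated amenable group and that $\mu$ is a non-degenerate probability measure on $G$. Assume in addition that $(G,\mu)$ is aperiodic. Then, for each $g\in G$, $$\lim_{n\to\infty}\frac{\mu^{*n}(g)}{\mu^{*n}(e)}=e^{-\langle\xi,\pi(g)\rangle},$$ where $\xi\in\mathbb{R}^k$ is the unique value for which $\lambda(G,\mu)=\phi_\mu(\xi)$.
   Context: A probability measure on a countable group $G$ is a function $\mu:G\to[0,\infty)$ with $\sum_{g\in G}\mu(g)=1$; its support is $S_\mu=\{g\in G:\mu(g)>0\}$ (not assumed finite). $\mu$ is non-degenerate if $S_\mu$ generates $G$ as a semigroup. Convolution is $\mu*\nu(g)=\sum_{s\in G}\mu(s)\nu(s^{-1}g)$, and $\mu^{*n}$ denotes the $n$-fold convolution power. $(G,\mu)$ is aperiodic if there exists $n_0\ge1$ such that $\mu^{*n}(e)>0$ for all $n\ge n_0$, where $e$ is the identity. The spectral radius is $\lambda(G,\mu)=\limsup_{n\to\infty}(\mu^{*n}(e))^{1/n}$. Let $G^{\mathrm{ab}}=G/[G,G]$, let $G^{\mathrm{ab}}_{\mathrm T}$ be its torsion subgroup, and let $\overline{G}=G^{\mathrm{ab}}/G^{\mathrm{ab}}_{\mathrm T}\cong\mathbb{Z}^k$ for some $k\ge 0$ (fix an identification with $\mathbb{Z}^k$), with $\pi:G\to\overline{G}$ the natural projection. Define $\phi_\mu:\mathbb{R}^k\to(0,\infty]$ by $\phi_\mu(v)=\sum_{g\in G}e^{\langle v,\pi(g)\rangle}\mu(g)$, where $\langle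 v,m\rangle=v_1m_1+\cdots+v_km_k$. (By a result of Stone, $\phi_\mu$ attains its minimum over $\mathbb{R}^k$ at a unique point; for amenable $G$, $\xi$ is this point.) Amenability of $G$ means existence of a translation-invariant mean on $\ell^\infty(G)$. *)

theory Defs
  imports
    "HOL-Analysis.Analysis"
    "HOL-Algebra.Generated_Groups"
    "HOL-Algebra.Product_Groups"
begin

section \<open>Groups\<close>

definition finitely_generated_group :: "('a, 'b) monoid_scheme \<Rightarrow> bool" where
  "finitely_generated_group G \<longleftrightarrow>
     (\<exists>S. finite S \<and> S \<subseteq> carrier G \<and> generate G S = carrier G)"

inductive_set semigroup_generated :: "('a, 'b) monoid_scheme \<Rightarrow> 'a set \<Rightarrow> 'a set"
  for G and S where
  incl: "s \<in> S \<Longrightarrow> s \<in> semigroup_generated G S"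
| mult: "a \<in> semigroup_generated G S \<Longrightarrow> b \<in> semigroup_generated G S
    \<Longrightarrow> a \<otimes>\<^bsub>G\<^esub> b \<in> semigroup_generated G S"

text \<open>
  Elements of \<open>\<ell>\<^sup>\<infinity>(G)\<close> are represented by functions on the whole type that are bounded on the
  carrier.  By linearity and positivity a mean takes the same value on two such functions that
  agree on the carrier, so it is a functional on \<open>\<ell>\<^sup>\<infinity>(G)\<close> proper.
\<close>

definition linf :: "('a, 'b) monoid_scheme \<Rightarrow> ('a \<Rightarrow> real) set" where
  "linf G = {f. bounded (f ` carrier G)}"

definition is_mean :: "('a, 'b) monoid_scheme \<Rightarrow> (('a \<Rightarrow> real) \<Rightarrow> real) \<Rightarrow> bool" where
  "is_mean G m \<longleftrightarrow>
     (\<forall>f\<in>linf G. \<forall>h\<in>linf G. m (\<lambda>x. f x + h x) = m f + m h) \<and>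
     (\<forall>c. \<forall>f\<in>linf G. m (\<lambda>x. c * f x) = c * m f) \<and>
     (\<forall>f\<in>linf G. (\<forall>x\<in>carrier G. 0 \<le> f x) \<longrightarrow> 0 \<le> m f) \<and>
     m (\<lambda>x. 1) = 1"

definition translation_invariant ::
    "('a, 'b) monoid_scheme \<Rightarrow> (('a \<Rightarrow> real) \<Rightarrow> real) \<Rightarrow> bool" where
  "translation_invariant G m \<longleftrightarrow>
     (\<forall>g\<in>carrier G. \<forall>f\<in>linf G. m (\<lambda>x. f (g \<otimes>\<^bsub>G\<^esub> x)) = m f)"

definition amenable :: "('a, 'b) monoid_scheme \<Rightarrow> bool" where
  "amenable G \<longleftrightarrow> (\<exists>m. is_mean G m \<and> translation_invariant G m)"


section \<open>The torsion-free abelianization\<close>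

definition abelianization :: "('a, 'b) monoid_scheme \<Rightarrow> 'a set monoid" where
  "abelianization G = G Mod derived G (carrier G)"

definition torsion :: "('a, 'b) monoid_scheme \<Rightarrow> 'a set" where
  "torsion A = {x \<in> carrier A. \<exists>n>0. x [^]\<^bsub>A\<^esub> (n::nat) = \<one>\<^bsub>A\<^esub>}"

definition Gbar :: "('a, 'b) monoid_scheme \<Rightarrow> 'a set set monoid" where
  "Gbar G = abelianization G Mod torsion (abelianization G)"

definition proj :: "('a, 'b) monoid_scheme \<Rightarrow> 'a \<Rightarrow> 'a set set" where
  "proj G g = torsion (abelianization G) #>\<^bsub>abelianization G\<^esub> (derived G (carrier G) #>\<^bsub>G\<^esub> g)"

text \<open>
  The rank \<open>k\<close> depends on the group and may be \<open>0\<close>, so it is a number rather than a type.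
  Elements of \<open>\<int>\<^sup>k\<close> and \<open>\<real>\<^sup>k\<close> are extensional functions on \<open>{..<k}\<close>, i.e. they are
  \<open>undefined\<close> outside \<open>{..<k}\<close>, so that they are determined by their \<open>k\<close> coordinates.
\<close>

abbreviation Zpow :: "nat \<Rightarrow> (nat \<Rightarrow> int) monoid" where
  "Zpow k \<equiv> product_group {..<k} (\<lambda>_. integer_group)"

abbreviation Rpow :: "nat \<Rightarrow> (nat \<Rightarrow> real) set" where
  "Rpow k \<equiv> {..<k} \<rightarrow>\<^sub>E UNIV"

definition pairing :: "nat \<Rightarrow> (nat \<Rightarrow> real) \<Rightarrow> (nat \<Rightarrow> int) \<Rightarrow> real" where
  "pairing k v m = (\<Sum>i<k. v i * real_of_int (m i))"


section \<open>Probability measures on groups\<close>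

definition prob_measure_on :: "('a, 'b) monoid_scheme \<Rightarrow> ('a \<Rightarrow> real) \<Rightarrow> bool" where
  "prob_measure_on G \<mu> \<longleftrightarrow> (\<forall>g\<in>carrier G. 0 \<le> \<mu> g) \<and> (\<mu> has_sum 1) (carrier G)"

definition supp :: "('a, 'b) monoid_scheme \<Rightarrow> ('a \<Rightarrow> real) \<Rightarrow> 'a set" where
  "supp G \<mu> = {g \<in> carrier G. \<mu> g > 0}"

definition non_degenerate :: "('a, 'b) monoid_scheme \<Rightarrow> ('a \<Rightarrow> real) \<Rightarrow> bool" where
  "non_degenerate G \<mu> \<longleftrightarrow> semigroup_generated G (supp G \<mu>) = carrier G"

definition conv ::
    "('a, 'b) monoid_scheme \<Rightarrow> ('a \<Rightarrow> real) \<Rightarrow> ('a \<Rightarrow> real) \<Rightarrow> 'a \<Rightarrow> real" where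
  "conv G \<mu> \<nu> g = (\<Sum>\<^sub>\<infinity>s\<in>carrier G. \<mu> s * \<nu> (inv\<^bsub>G\<^esub> s \<otimes>\<^bsub>G\<^esub> g))"

primrec conv_pow :: "('a, 'b) monoid_scheme \<Rightarrow> ('a \<Rightarrow> real) \<Rightarrow> nat \<Rightarrow> 'a \<Rightarrow> real" where
  "conv_pow G \<mu> 0 = (\<lambda>g. if g = \<one>\<^bsub>G\<^esub> then 1 else 0)"
| "conv_pow G \<mu> (Suc n) = conv G \<mu> (conv_pow G \<mu> n)"

definition aperiodic :: "('a, 'b) monoid_scheme \<Rightarrow> ('a \<Rightarrow> real) \<Rightarrow> bool" where
  "aperiodic G \<mu> \<longleftrightarrow> (\<exists>n0\<ge>1. \<forall>n\<ge>n0. conv_pow G \<mu> n \<one>\<^bsub>G\<^esub> > 0)"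

definition spectral_radius :: "('a, 'b) monoid_scheme \<Rightarrow> ('a \<Rightarrow> real) \<Rightarrow> ennreal" where
  "spectral_radius G \<mu> = limsup (\<lambda>n. ennreal (root n (conv_pow G \<mu> n \<one>\<^bsub>G\<^esub>)))"

text \<open>
  The parameter \<open>\<psi>\<close> is the chosen identification of \<open>Gbar G\<close> with \<open>\<int>\<^sup>k\<close>.
\<close>

definition phi ::
    "('a, 'b) monoid_scheme \<Rightarrow> nat \<Rightarrow> ('a set set \<Rightarrow> nat \<Rightarrow> int) \<Rightarrow> ('a \<Rightarrow> real) \<Rightarrow>
     (nat \<Rightarrow> real) \<Rightarrow> ennreal" where
  "phi G k \<psi> \<mu> v = (\<Sum>\<^sub>\<infinity>g\<in>carrier G. ennreal (exp (pairing k v (\<psi> (proj G g))) * \<mu> g))"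

end

theory Submission
  imports Defs
begin

text \<open>
  Let \<open>a\<^sub>n\<close> be the return probabilities and \<open>\<Lambda> = lim a\<^sub>n powr (1 / n)\<close>.

  Existence of \<open>\<xi>\<close>: for \<open>c > \<Lambda>\<close> the Green function \<open>f g = (\<Sum>n. \<mu>\<^sup>n g / c ^ n)\<close> is positive and
  \<open>c\<close>-superharmonic. Averaging the cocycle \<open>ln (f (inv s \<otimes> g)) - ln (f g)\<close> over \<open>g\<close> by an
  invariant mean gives a homomorphism \<open>L\<close> from \<open>G\<close> to the reals, and Jensen's inequality gives
  \<open>(\<Sum>s. \<mu> s * exp (L s)) \<le> c\<close>. By compactness the bound also holds for \<open>c = \<Lambda>\<close> with some \<open>L\<close>,
  which is \<open>\<langle>\<xi>, \<pi>(\<cdot>)\<rangle>\<close>. The reverse inequality holds for every homomorphism, because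
  \<open>exp (L s) * \<mu> s\<close>, normalised, is again a probability measure.

  Ratio limit: this change of measure reduces the claim to \<open>\<Lambda> = 1\<close> and \<open>L = 0\<close>. Cut the
  closed words of length \<open>n\<close> into \<open>q\<close> blocks of length \<open>N\<close> and a rest, with \<open>\<mu>\<^sup>N x > 0\<close>, and let \<open>K\<close> be
  the number of blocks with product \<open>x\<close>. By cyclic rotation of words the mean of \<open>K\<close> is
  \<open>q * \<mu>\<^sup>N x * \<mu>\<^bsup>n - N\<^esup> (inv x) / a\<^sub>n\<close>. On the other hand \<open>exp (t * K)\<close> has total
  weight at most \<open>(1 + (exp t - 1) * \<mu>\<^sup>N x) ^ q\<close>, and \<open>a\<^sub>n\<close> decays subexponentially, so that Jensen's
  inequality for small \<open>t\<close> of either sign forces the mean of \<open>K\<close> to be \<open>q * \<mu>\<^sup>N x * (1 + o(1))\<close>.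

  Uniqueness of \<open>\<xi>\<close> follows from uniqueness of the ratio limit.
\<close>

section \<open>Convolution\<close>

context group
begin

lemma inv_cancel_left [simp]:
  assumes "x \<in> carrier G" "y \<in> carrier G"
  shows "inv x \<otimes> (x \<otimes> y) = y" "x \<otimes> (inv x \<otimes> y) = y"
  using assms by (simp_all flip: m_assoc)

lemma summable_conv:
  fixes f h :: "'a \<Rightarrow> real"
  assumes f: "f summable_on carrier G" "\<And>s. s \<in> carrier G \<Longrightarrow> 0 \<le> f s"
    and h: "\<And>s. s \<in> carrier G \<Longrightarrow> \<bar>h s\<bar> \<le> C" and g: "g \<in> carrier G"
  shows "(\<lambda>s. f s * h (inv s \<otimes> g)) summable_on carrier G"
proof -
  have "(\<lambda>s. f s * C) summable_on carrier G"
    using f(1) by (rule summable_on_cmult_left)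
  moreover have "norm (f s * h (inv s \<otimes> g)) \<le> f s * C" if "s \<in> carrier G" for s
    using f(2) h g that by (auto simp: abs_mult intro!: mult_mono)
  ultimately have "(\<lambda>s. norm (f s * h (inv s \<otimes> g))) summable_on carrier G"
    by (rule summable_on_comparison_test) auto
  then show ?thesis
    by (rule abs_summable_summable)
qed

lemma conv_mono:
  fixes f h k :: "'a \<Rightarrow> real"
  assumes f: "f summable_on carrier G" "\<And>s. s \<in> carrier G \<Longrightarrow> 0 \<le> f s"
    and h: "\<And>s. s \<in> carrier G \<Longrightarrow> \<bar>h s\<bar> \<le> C" and k: "\<And>s. s \<in> carrier G \<Longrightarrow> \<bar>k s\<bar> \<le> D"
    and le: "\<And>s. s \<in> carrier G \<Longrightarrow> h s \<le> k s" and g: "g \<in> carrier G"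
  shows "conv G f h g \<le> conv G f k g"
  unfolding conv_def using le f(2) g
  by (intro infsum_mono summable_conv[OF f h g] summable_conv[OF f k g] mult_left_mono) auto

lemma conv_const: "conv G f (\<lambda>_. C) g = infsum f (carrier G) * C"
  unfolding conv_def by (rule infsum_cmult_left')

lemma conv_nonneg:
  fixes f h :: "'a \<Rightarrow> real"
  assumes "\<And>s. s \<in> carrier G \<Longrightarrow> 0 \<le> f s" "\<And>s. s \<in> carrier G \<Longrightarrow> 0 \<le> h s" "g \<in> carrier G"
  shows "0 \<le> conv G f h g"
  unfolding conv_def using assms by (intro infsum_nonneg) auto

lemma conv_bounded:
  fixes f h :: "'a \<Rightarrow> real"
  assumes f: "f summable_on carrier G" "\<And>s. s \<in> carrier G \<Longrightarrow> 0 \<le> f s"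
    and h: "\<And>s. s \<in> carrier G \<Longrightarrow> \<bar>h s\<bar> \<le> C" and g: "g \<in> carrier G"
  shows "\<bar>conv G f h g\<bar> \<le> infsum f (carrier G) * C"
proof -
  have C: "0 \<le> C" using h[OF one_closed] by linarith
  have "conv G f h g \<le> conv G f (\<lambda>_. C) g"
    using h by (intro conv_mono[OF f h _ _ g, where D=C]) (auto simp: abs_le_iff C)
  moreover have "conv G f (\<lambda>_. - C) g \<le> conv G f h g"
    using h by (intro conv_mono[OF f _ h _ g, where C=C]) (auto simp: abs_le_iff C minus_le_iff)
  ultimately show ?thesis
    unfolding conv_const by auto
qed

lemma finite_sum_le_conv:
  fixes f h :: "'a \<Rightarrow> real"
  assumes f: "f summable_on carrier G" "\<And>s. s \<in> carrier G \<Longrightarrow> 0 \<le> f s"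
    and h: "\<And>s. s \<in> carrier G \<Longrightarrow> 0 \<le> h s" "\<And>s. s \<in> carrier G \<Longrightarrow> h s \<le> C"
    and F: "finite F" "F \<subseteq> carrier G" and g: "g \<in> carrier G"
  shows "(\<Sum>s\<in>F. f s * h (inv s \<otimes> g)) \<le> conv G f h g"
  unfolding conv_def
proof (rule finite_sum_le_infsum[OF _ F])
  show "(\<lambda>s. f s * h (inv s \<otimes> g)) summable_on carrier G"
    using h by (intro summable_conv[OF f _ g, where C=C]) (auto simp: abs_le_iff intro: order_trans[of _ 0])
qed (use f h g in auto)

lemma conv_cong:
  assumes "\<And>s. s \<in> carrier G \<Longrightarrow> f s = f' s" "\<And>s. s \<in> carrier G \<Longrightarrow> h s = h' s" "g \<in> carrier G"
  shows "conv G f h g = conv G f' h' g"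
  unfolding conv_def using assms by (intro infsum_cong) auto

lemma conv_add:
  fixes f h k :: "'a \<Rightarrow> real"
  assumes f: "f summable_on carrier G" "\<And>s. s \<in> carrier G \<Longrightarrow> 0 \<le> f s"
    and h: "\<And>s. s \<in> carrier G \<Longrightarrow> \<bar>h s\<bar> \<le> C" and k: "\<And>s. s \<in> carrier G \<Longrightarrow> \<bar>k s\<bar> \<le> D"
    and g: "g \<in> carrier G"
  shows "conv G f (\<lambda>s. a * h s + b * k s) g = a * conv G f h g + b * conv G f k g"
proof -
  have *: "(\<lambda>s. a * (f s * h (inv s \<otimes> g))) summable_on carrier G"
       "(\<lambda>s. b * (f s * k (inv s \<otimes> g))) summable_on carrier G"
    by (intro summable_on_cmult_right summable_conv[OF f h g] summable_conv[OF f k g]; assumption)+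
  have "conv G f (\<lambda>s. a * h s + b * k s) g
      = (\<Sum>\<^sub>\<infinity>s\<in>carrier G. a * (f s * h (inv s \<otimes> g)) + b * (f s * k (inv s \<otimes> g)))"
    unfolding conv_def by (simp add: algebra_simps)
  also have "\<dots> = a * conv G f h g + b * conv G f k g"
    unfolding infsum_add[OF *] conv_def by (simp add: infsum_cmult_right')
  finally show ?thesis .
qed

text \<open>The shear \<open>(s, t)\<close> to \<open>(s, s \<otimes> t)\<close> carries the product
  family \<open>f s * k t\<close> to this one. It gives the absolute convergence behind the
  exchanges of sums in \<open>infsum_conv\<close> and \<open>conv_assoc\<close>.\<close>

lemma summable_pairs:
  fixes f k :: "'a \<Rightarrow> real"
  assumes f: "f summable_on carrier G" "\<And>s. s \<in> carrier G \<Longrightarrow> 0 \<le> f s"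
    and k: "k summable_on carrier G" "\<And>s. s \<in> carrier G \<Longrightarrow> 0 \<le> k s"
  shows "(\<lambda>(s, u). f s * k (inv s \<otimes> u)) summable_on carrier G \<times> carrier G"
proof -
  have "(\<lambda>(s, t). f s * k t) summable_on carrier G \<times> carrier G"
  proof (rule summable_on_SigmaI)
    show "((\<lambda>y. case (x, y) of (s, t) \<Rightarrow> f s * k t) has_sum f x * infsum k (carrier G)) (carrier G)" for x
      using k(1) by (auto intro: has_sum_cmult_right)
    show "(\<lambda>x. f x * infsum k (carrier G)) summable_on carrier G"
      using f(1) by (rule summable_on_cmult_left)
  qed (use f(2) k(2) in auto)
  also have "?this \<longleftrightarrow> ?thesis"
    by (rule summable_on_reindex_bij_witness[of _ "\<lambda>(s, u). (s, inv s \<otimes> u)" "\<lambda>(s, t). (s, s \<otimes> t)"])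
       auto
  finally show ?thesis .
qed

lemma
  fixes f k :: "'a \<Rightarrow> real"
  assumes f: "f summable_on carrier G" "\<And>s. s \<in> carrier G \<Longrightarrow> 0 \<le> f s"
    and k: "k summable_on carrier G" "\<And>s. s \<in> carrier G \<Longrightarrow> 0 \<le> k s"
  shows summable_conv_fun: "conv G f k summable_on carrier G"
    and infsum_conv: "infsum (conv G f k) (carrier G) = infsum f (carrier G) * infsum k (carrier G)"
proof -
  have sum: "(\<lambda>(u, s). f s * k (inv s \<otimes> u)) summable_on carrier G \<times> carrier G"
    using summable_pairs[OF f k] unfolding summable_on_swap[of "\<lambda>(s, u). f s * k (inv s \<otimes> u)"]
    by (simp add: case_prod_unfold)
  show "conv G f k summable_on carrier G"
    using summable_on_Sigma_banach[OF sum] unfolding conv_def .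
  have "infsum (conv G f k) (carrier G)
      = (\<Sum>\<^sub>\<infinity>s\<in>carrier G. \<Sum>\<^sub>\<infinity>u\<in>carrier G. f s * k (inv s \<otimes> u))"
    unfolding conv_def by (rule infsum_swap_banach[OF sum])
  also have "\<dots> = (\<Sum>\<^sub>\<infinity>s\<in>carrier G. f s * infsum k (carrier G))"
  proof (rule infsum_cong)
    fix s assume s: "s \<in> carrier G"
    have "(\<Sum>\<^sub>\<infinity>u\<in>carrier G. k (inv s \<otimes> u)) = infsum k (carrier G)"
      using s by (intro infsum_reindex_bij_witness[of _ "\<lambda>t. s \<otimes> t" "\<lambda>u. inv s \<otimes> u"])
        auto
    then show "(\<Sum>\<^sub>\<infinity>u\<in>carrier G. f s * k (inv s \<otimes> u)) = f s * infsum k (carrier G)"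
      by (simp add: infsum_cmult_right')
  qed
  also have "\<dots> = infsum f (carrier G) * infsum k (carrier G)"
    by (simp add: infsum_cmult_left')
  finally show "infsum (conv G f k) (carrier G) = infsum f (carrier G) * infsum k (carrier G)" .
qed

text \<open>Fubini for the double sum over \<open>(s, u)\<close>, dominated by \<open>C\<close>
  times the family of \<open>summable_pairs\<close>, then the substitution
  \<open>u = s \<otimes> t\<close>.\<close>

lemma conv_assoc:
  fixes f k h :: "'a \<Rightarrow> real"
  assumes f: "f summable_on carrier G" "\<And>s. s \<in> carrier G \<Longrightarrow> 0 \<le> f s"
    and k: "k summable_on carrier G" "\<And>s. s \<in> carrier G \<Longrightarrow> 0 \<le> k s"
    and h: "\<And>s. s \<in> carrier G \<Longrightarrow> \<bar>h s\<bar> \<le> C" and g: "g \<in> carrier G"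
  shows "conv G (conv G f k) h g = conv G f (conv G k h) g"
proof -
  have C: "0 \<le> C" using h[OF one_closed] by linarith
  have "(\<lambda>p. (case p of (s, u) \<Rightarrow> f s * k (inv s \<otimes> u)) * C) summable_on carrier G \<times> carrier G"
    by (rule summable_on_cmult_left[OF summable_pairs[OF f k]])
  then have "(\<lambda>p. norm (case p of (s, u) \<Rightarrow> f s * k (inv s \<otimes> u) * h (inv u \<otimes> g)))
      summable_on carrier G \<times> carrier G"
    by (rule summable_on_comparison_test)
       (use f(2) k(2) h g C in \<open>auto simp: abs_mult intro!: mult_mono\<close>)
  then have sum: "(\<lambda>(s, u). f s * k (inv s \<otimes> u) * h (inv u \<otimes> g)) summable_on carrier G \<times> carrier G"
    by (rule abs_summable_summable)
  then have sum': "(\<lambda>(u, s). f s * k (inv s \<otimes> u) * h (inv u \<otimes> g)) summable_on carrier G \<times> carrier G"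
    by (subst summable_on_swap) (simp add: case_prod_unfold)
  have "conv G (conv G f k) h g
      = (\<Sum>\<^sub>\<infinity>u\<in>carrier G. \<Sum>\<^sub>\<infinity>s\<in>carrier G. f s * k (inv s \<otimes> u) * h (inv u \<otimes> g))"
    unfolding conv_def by (simp add: infsum_cmult_left')
  also have "\<dots> = (\<Sum>\<^sub>\<infinity>s\<in>carrier G. \<Sum>\<^sub>\<infinity>u\<in>carrier G. f s * k (inv s \<otimes> u) * h (inv u \<otimes> g))"
    by (rule infsum_swap_banach[OF sum'])
  also have "\<dots> = conv G f (conv G k h) g"
    unfolding conv_def
  proof (rule infsum_cong)
    fix s assume s: "s \<in> carrier G"
    have "(\<Sum>\<^sub>\<infinity>u\<in>carrier G. k (inv s \<otimes> u) * h (inv u \<otimes> g))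
        = (\<Sum>\<^sub>\<infinity>t\<in>carrier G. k t * h (inv t \<otimes> (inv s \<otimes> g)))"
      using s g by (intro infsum_reindex_bij_witness[of _ "\<lambda>t. s \<otimes> t" "\<lambda>u. inv s \<otimes> u"])
        (auto simp: m_assoc inv_mult_group)
    then show "(\<Sum>\<^sub>\<infinity>u\<in>carrier G. f s * k (inv s \<otimes> u) * h (inv u \<otimes> g))
        = f s * (\<Sum>\<^sub>\<infinity>t\<in>carrier G. k t * h (inv t \<otimes> (inv s \<otimes> g)))"
      by (simp add: infsum_cmult_right' mult.assoc)
  qed
  finally show ?thesis .
qed

lemma conv_delta_left:
  fixes h :: "'a \<Rightarrow> real"
  assumes "g \<in> carrier G"
  shows "conv G (\<lambda>x. if x = \<one> then 1 else 0) h g = h g"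
proof -
  have "conv G (\<lambda>x. if x = \<one> then 1 else 0) h g = (\<Sum>\<^sub>\<infinity>s\<in>{\<one>}. 1 * h (inv s \<otimes> g))"
    unfolding conv_def by (rule infsum_cong_neutral) (use assms in auto)
  then show ?thesis using assms by simp
qed

lemma conv_delta_right:
  fixes f :: "'a \<Rightarrow> real"
  assumes "g \<in> carrier G"
  shows "conv G f (\<lambda>x. if x = \<one> then 1 else 0) g = f g"
proof -
  have eq: "inv s \<otimes> g = \<one> \<longleftrightarrow> s = g" if "s \<in> carrier G" for s
    using assms that by (metis inv_closed inv_inv inv_unique l_inv r_inv)
  have "conv G f (\<lambda>x. if x = \<one> then 1 else 0) g = (\<Sum>\<^sub>\<infinity>s\<in>{g}. f s)"
    unfolding conv_def by (rule infsum_cong_neutral) (use assms eq in auto)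
  then show ?thesis by simp
qed

text \<open>Substitute \<open>s = inv t \<otimes> inv x\<close>. This is the trace property at the
  identity, which performs the cyclic rotation of closed words.\<close>

lemma conv_at_inv:
  fixes f h :: "'a \<Rightarrow> real"
  assumes "x \<in> carrier G"
  shows "conv G f (\<lambda>s. h (inv x \<otimes> s)) \<one> = conv G h f (inv x)"
  unfolding conv_def
  using assms
  by (intro infsum_reindex_bij_witness[of _ "\<lambda>t. inv t \<otimes> inv x" "\<lambda>s. inv x \<otimes> inv s"])
     (auto simp: m_assoc inv_mult_group)

text \<open>Blocks with product \<open>x\<close> are singled out by changing a block distribution at
  \<open>x\<close> alone: a factor \<open>exp t\<close> there weights them, the value
  \<open>0\<close> removes them.\<close>

lemma
  fixes f h :: "'a \<Rightarrow> real"
  assumes f: "f summable_on carrier G" "\<And>s. s \<in> carrier G \<Longrightarrow> 0 \<le> f s"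
    and x: "x \<in> carrier G"
  shows summable_upd: "f(x := c) summable_on carrier G"
    and infsum_upd: "infsum (f(x := c)) (carrier G) = infsum f (carrier G) + (c - f x)"
    and conv_upd: "\<lbrakk>\<And>s. s \<in> carrier G \<Longrightarrow> \<bar>h s\<bar> \<le> C; g \<in> carrier G\<rbrakk>
      \<Longrightarrow> conv G (f(x := c)) h g = conv G f h g + (c - f x) * h (inv x \<otimes> g)"
proof -
  have single: "((\<lambda>s. if s = x then d else 0) has_sum d) (carrier G)" for d :: real
  proof -
    have "((\<lambda>s. d) has_sum d) {x}" by (rule has_sum_finiteI) auto
    then show ?thesis
      by (subst has_sum_cong_neutral[where T = "{x}" and g = "\<lambda>_. d"]) (use x in auto)
  qed
  have "((\<lambda>s. f s + (if s = x then c - f x else 0)) has_sum infsum f (carrier G) + (c - f x)) (carrier G)"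
    by (intro has_sum_add has_sum_infsum f(1) single)
  also have "(\<lambda>s. f s + (if s = x then c - f x else 0)) = f(x := c)"
    by auto
  finally show "f(x := c) summable_on carrier G"
    "infsum (f(x := c)) (carrier G) = infsum f (carrier G) + (c - f x)"
    unfolding has_sum_iff by blast+
  assume h: "\<And>s. s \<in> carrier G \<Longrightarrow> \<bar>h s\<bar> \<le> C" and g: "g \<in> carrier G"
  have "((\<lambda>s. f s * h (inv s \<otimes> g) + (if s = x then (c - f x) * h (inv x \<otimes> g) else 0))
      has_sum (conv G f h g + (c - f x) * h (inv x \<otimes> g))) (carrier G)"
    unfolding conv_def by (intro has_sum_add has_sum_infsum summable_conv[OF f h g] single)
  also have "(\<lambda>s. f s * h (inv s \<otimes> g) + (if s = x then (c - f x) * h (inv x \<otimes> g) else 0))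
      = (\<lambda>s. (f(x := c)) s * h (inv s \<otimes> g))"
    by (auto simp: algebra_simps)
  finally show "conv G (f(x := c)) h g = conv G f h g + (c - f x) * h (inv x \<otimes> g)"
    unfolding conv_def by (auto simp: has_sum_iff)
qed

lemma conv_sum:
  fixes f :: "'a \<Rightarrow> real"
  assumes f: "f summable_on carrier G" "\<And>s. s \<in> carrier G \<Longrightarrow> 0 \<le> f s"
    and h: "\<And>j s. s \<in> carrier G \<Longrightarrow> \<bar>h j s\<bar> \<le> C" and g: "g \<in> carrier G" and J: "finite J"
  shows "conv G f (\<lambda>s. \<Sum>j\<in>J. h j s) g = (\<Sum>j\<in>J. conv G f (h j) g)"
proof -
  have "((\<lambda>s. f s * (\<Sum>j\<in>J. h j (inv s \<otimes> g))) has_sum (\<Sum>j\<in>J. conv G f (h j) g)) (carrier G)"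
    using J
  proof induction
    case (insert j J)
    have "((\<lambda>s. f s * h j (inv s \<otimes> g)) has_sum conv G f (h j) g) (carrier G)"
      unfolding conv_def by (intro has_sum_infsum summable_conv[OF f h g])
    from has_sum_add[OF this insert.IH] insert.hyps show ?case
      by (simp add: distrib_left)
  qed simp
  then show ?thesis unfolding conv_def by (rule infsumI)
qed

end

section \<open>Additive functions on the group\<close>

lemma (in comm_group) torsion_normal: "torsion G \<lhd> G"
proof (rule normal_iff_subgroup[THEN iffD2], rule subgroupI)
  show "torsion G \<subseteq> carrier G" by (auto simp: torsion_def)
  have "\<one> \<in> torsion G" by (auto simp: torsion_def)
  then show "torsion G \<noteq> {}" by blast
  show "inv a \<in> torsion G" if "a \<in> torsion G" for a
    using that by (auto simp: torsion_def nat_pow_inv)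
  show "a \<otimes> b \<in> torsion G" if ab: "a \<in> torsion G" "b \<in> torsion G" for a b
  proof -
    obtain m n :: nat where mn: "0 < m" "a [^] m = \<one>" "0 < n" "b [^] n = \<one>"
      "a \<in> carrier G" "b \<in> carrier G"
      using ab by (auto simp: torsion_def)
    have "a [^] (m * n) = \<one>"
      using nat_pow_pow[of a m n] mn by simp
    moreover have "b [^] (m * n) = \<one>"
      using nat_pow_pow[of b n m] mn by (simp add: mult.commute[of m])
    ultimately have "(a \<otimes> b) [^] (m * n) = \<one>"
      using mn by (simp add: nat_pow_distrib)
    then show ?thesis using mn by (auto simp: torsion_def intro!: exI[of _ "m * n"])
  qed
qed

context group
begin

lemma abelianization_comm_group: "comm_group (abelianization G)"
  unfolding abelianization_def by (rule derived_quot_is_comm_group)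

lemma torsion_abelianization_normal: "torsion (abelianization G) \<lhd> abelianization G"
  by (rule comm_group.torsion_normal[OF abelianization_comm_group])

lemma proj_hom: "proj G \<in> hom G (Gbar G)"
proof -
  have "(\<lambda>a. derived G (carrier G) #> a) \<in> hom G (abelianization G)"
    unfolding abelianization_def by (rule normal.r_coset_hom_Mod[OF derived_self_is_normal])
  moreover have "(\<lambda>a. torsion (abelianization G) #>\<^bsub>abelianization G\<^esub> a) \<in> hom (abelianization G) (Gbar G)"
    unfolding Gbar_def by (rule normal.r_coset_hom_Mod[OF torsion_abelianization_normal])
  ultimately show ?thesis
    by (simp add: hom_def proj_def Pi_iff)
qed

lemma proj_surj: "proj G ` carrier G = carrier (Gbar G)"
  unfolding proj_def[abs_def] Gbar_def carrier_FactGroup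
  by (simp add: abelianization_def carrier_FactGroup image_image)

section \<open>Homomorphisms to the reals\<close>

context
  fixes L :: "'a \<Rightarrow> real"
  assumes L: "\<And>x y. \<lbrakk>x \<in> carrier G; y \<in> carrier G\<rbrakk> \<Longrightarrow> L (x \<otimes> y) = L x + L y"
begin

lemma additive_one: "L \<one> = 0"
  using L[of \<one> \<one>] by simp

lemma additive_inv: "x \<in> carrier G \<Longrightarrow> L (inv x) = - L x"
  using L[of x "inv x"] additive_one by simp

lemma additive_pow: "x \<in> carrier G \<Longrightarrow> L (x [^] n) = n * L x" for n :: nat
  by (induction n) (simp_all add: additive_one L algebra_simps)

lemma additive_derived:
  assumes "x \<in> derived G (carrier G)"
  shows "L x = 0"
proof -
  have "x \<in> generate G (derived_set G (carrier G))" using assms by (simp add: derived_def)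
  then show ?thesis
  proof induction
    case (eng a b)
    have "a \<in> carrier G" "b \<in> carrier G"
      using eng generate_in_carrier[OF derived_set_in_carrier[of "carrier G"]] by auto
    then show ?case using eng by (simp add: L)
  qed (auto simp: additive_one L additive_inv)
qed

text \<open>The reals are commutative and torsion-free, so \<open>L\<close> vanishes on commutators
  and on elements that are torsion in the abelianization. Hence it factors through
  \<open>Gbar G\<close>.\<close>

lemma additive_proj_cong:
  assumes g: "g \<in> carrier G" and h: "h \<in> carrier G" and eq: "proj G g = proj G h"
  shows "L g = L h"
proof -
  let ?D = "derived G (carrier G)" and ?A = "abelianization G"
  interpret A: comm_group ?A by (rule abelianization_comm_group)
  interpret D: normal ?D G by (rule derived_self_is_normal)
  interpret T: normal "torsion ?A" ?A by (rule torsion_abelianization_normal)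
  have coset: "?D #> x \<in> carrier ?A" if "x \<in> carrier G" for x
    using that by (auto simp: abelianization_def carrier_FactGroup)
  have "?D #> g \<in> torsion ?A #>\<^bsub>?A\<^esub> (?D #> h)"
    using A.rcos_self[OF coset[OF g] T.subgroup_axioms]
    by (simp only: eq[unfolded proj_def])
  then obtain \<tau> where \<tau>: "\<tau> \<in> torsion ?A" "?D #> g = \<tau> \<otimes>\<^bsub>?A\<^esub> (?D #> h)"
    by (auto simp: r_coset_def)
  then obtain n :: nat where n: "0 < n" "\<tau> [^]\<^bsub>?A\<^esub> n = \<one>\<^bsub>?A\<^esub>" "\<tau> \<in> carrier ?A"
    unfolding torsion_def by blast
  \<comment> \<open>A representative \<open>d\<close> of the torsion coset has
    \<open>d [^] n\<close> in the derived subgroup, so \<open>n * L d = 0\<close>.\<close>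
  then obtain d where d: "d \<in> carrier G" "\<tau> = ?D #> d"
    by (auto simp: abelianization_def carrier_FactGroup)
  have "?D #> (d [^] n) = ?D"
    using n d D.FactGroup_pow[of d n] by (simp add: abelianization_def)
  then have "L (d [^] n) = 0"
    using rcos_self[of "d [^] n" ?D] d D.subgroup_axioms additive_derived by auto
  then have "L d = 0" using n d by (simp add: additive_pow)
  moreover have "?D #> g = ?D #> (d \<otimes> h)"
    using \<tau> d h by (simp add: abelianization_def D.rcos_sum)
  then obtain x where "x \<in> ?D" "g = x \<otimes> (d \<otimes> h)"
    using rcos_self[OF g D.subgroup_axioms] by (auto simp: r_coset_def)
  ultimately show ?thesis
    using d h D.subset by (auto simp: L additive_derived)
qed

end

section \<open>Coordinates on \<open>Gbar G\<close>\<close>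

context
  fixes k :: nat and \<psi> :: "'a set set \<Rightarrow> nat \<Rightarrow> int"
  assumes \<psi>: "\<psi> \<in> iso (Gbar G) (Zpow k)"
begin

lemma coords_surj:
  assumes "m \<in> {..<k} \<rightarrow>\<^sub>E UNIV"
  obtains g where "g \<in> carrier G" "\<psi> (proj G g) = m"
proof -
  have "m \<in> \<psi> ` proj G ` carrier G"
    using \<psi> assms by (auto simp: iso_def bij_betw_def proj_surj)
  then show ?thesis using that by auto
qed

lemma coords_in: "g \<in> carrier G \<Longrightarrow> \<psi> (proj G g) \<in> {..<k} \<rightarrow>\<^sub>E UNIV"
  using \<psi> proj_hom by (auto simp: iso_def hom_def Pi_iff)

lemma coords_mult:
  assumes "x \<in> carrier G" "y \<in> carrier G"
  shows "\<psi> (proj G (x \<otimes> y)) = (\<lambda>i\<in>{..<k}. \<psi> (proj G x) i + \<psi> (proj G y) i)"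
proof -
  have "proj G (x \<otimes> y) = proj G x \<otimes>\<^bsub>Gbar G\<^esub> proj G y"
    using hom_mult[OF proj_hom assms] .
  moreover have "proj G x \<in> carrier (Gbar G)" "proj G y \<in> carrier (Gbar G)"
    using assms proj_surj by auto
  ultimately show ?thesis
    using \<psi> hom_mult[of \<psi> "Gbar G" "Zpow k" "proj G x" "proj G y"] by (simp add: iso_def)
qed

lemma pairing_coords_mult:
  assumes "x \<in> carrier G" "y \<in> carrier G"
  shows "pairing k v (\<psi> (proj G (x \<otimes> y))) = pairing k v (\<psi> (proj G x)) + pairing k v (\<psi> (proj G y))"
  using assms by (simp add: coords_mult pairing_def distrib_left sum.distrib)

text \<open>Through the surjective coordinates \<open>L\<close> descends to an additive map
  \<open>M\<close> on the integer lattice. Its values on the unit vectors determine it and are the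
  coordinates of \<open>v\<close>.\<close>

lemma additive_eq_pairing:
  fixes L :: "'a \<Rightarrow> real"
  assumes L: "\<And>x y. \<lbrakk>x \<in> carrier G; y \<in> carrier G\<rbrakk> \<Longrightarrow> L (x \<otimes> y) = L x + L y"
  obtains v where "v \<in> Rpow k" "\<And>g. g \<in> carrier G \<Longrightarrow> L g = pairing k v (\<psi> (proj G g))"
proof -
  let ?Z = "{..<k} \<rightarrow>\<^sub>E (UNIV :: int set)"
  have "\<forall>m\<in>?Z. \<exists>g. g \<in> carrier G \<and> \<psi> (proj G g) = m"
    using coords_surj by blast
  then obtain s where s: "\<And>m. m \<in> ?Z \<Longrightarrow> s m \<in> carrier G \<and> \<psi> (proj G (s m)) = m"
    by (auto simp: bchoice_iff)
  define M where "M m = L (s m)" for m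
  have inj: "inj_on \<psi> (carrier (Gbar G))" using \<psi> by (auto simp: iso_def bij_betw_def)
  have M: "M (\<psi> (proj G g)) = L g" if g: "g \<in> carrier G" for g
  proof -
    have "proj G (s (\<psi> (proj G g))) = proj G g"
      using s[OF coords_in[OF g]] g proj_surj by (intro inj_onD[OF inj]) auto
    then show ?thesis
      unfolding M_def using s[OF coords_in[OF g]] g by (intro additive_proj_cong L) auto
  qed
  have M_add: "M (\<lambda>i\<in>{..<k}. m i + n i) = M m + M n" if "m \<in> ?Z" "n \<in> ?Z" for m n
    using s[OF that(1)] s[OF that(2)] M[of "s m \<otimes> s n"] by (simp add: coords_mult L M_def)
  \<comment> \<open>\<open>S j z\<close> is \<open>z\<close> times the \<open>j\<close>-th unit
    vector, and the zero vector if \<open>j \<ge> k\<close>.\<close>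
  define S where "S j z = (\<lambda>i\<in>{..<k}. if i = j then z else 0)" for j and z :: int
  have S_in: "S j z \<in> ?Z" for j z by (simp add: S_def)
  have S_add: "M (S j (y + z)) = M (S j y) + M (S j z)" for j y z
  proof -
    have "S j (y + z) = (\<lambda>i\<in>{..<k}. S j y i + S j z i)"
      by (auto simp: S_def fun_eq_iff)
    then show ?thesis using M_add[OF S_in S_in] by simp
  qed
  have S_mult: "M (S j z) = z * M (S j 1)" for j z
  proof (induction z rule: int_induct[where k = 0])
    case base
    show ?case using S_add[of j 0 0] by simp
  next
    case (step1 z)
    then show ?case using S_add[of j z 1] by (simp add: algebra_simps)
  next
    case (step2 z)
    then show ?case using S_add[of j "z - 1" 1] by (simp add: algebra_simps)
  qed
  \<comment> \<open>The coordinates of \<open>m\<close> are switched on one at a time; at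
    \<open>j = k\<close> the truncation is all of \<open>m\<close>.\<close>
  have expand: "M (\<lambda>i\<in>{..<k}. if i < j then m i else 0) = (\<Sum>i<j. M (S i 1) * m i)" for m j
  proof (induction j)
    case 0
    have "(\<lambda>i\<in>{..<k}. if i < 0 then m i else 0) = S 0 0" by (auto simp: S_def)
    then show ?case using S_mult[of 0 0] by simp
  next
    case (Suc j)
    have *: "(\<lambda>i\<in>{..<k}. if i < Suc j then m i else 0)
        = (\<lambda>i\<in>{..<k}. (\<lambda>i\<in>{..<k}. if i < j then m i else 0) i + S j (m j) i)"
      by (auto simp: S_def fun_eq_iff less_Suc_eq)
    have "M (\<lambda>i\<in>{..<k}. if i < Suc j then m i else 0)
        = M (\<lambda>i\<in>{..<k}. if i < j then m i else 0) + M (S j (m j))"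
      unfolding * by (rule M_add[OF _ S_in]) (unfold restrict_PiE_iff, simp)
    then show ?case using Suc S_mult[of j "m j"] by (simp only: sum.lessThan_Suc mult.commute)
  qed
  define v where "v = (\<lambda>i\<in>{..<k}. M (S i 1))"
  have "L g = pairing k v (\<psi> (proj G g))" if g: "g \<in> carrier G" for g
  proof -
    let ?m = "\<psi> (proj G g)"
    have "restrict (\<lambda>i. if i < k then ?m i else 0) {..<k} = restrict ?m {..<k}"
      by (rule restrict_ext) simp
    also have "\<dots> = ?m"
      using coords_in[OF g] by (rule PiE_restrict)
    finally have "M ?m = (\<Sum>i<k. M (S i 1) * ?m i)"
      using expand[of k ?m] by (simp only:)
    then have "L g = (\<Sum>i<k. M (S i 1) * ?m i)" by (simp only: M[OF g])
    then show ?thesis by (simp add: pairing_def v_def)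
  qed
  then show ?thesis using that[of v] by (auto simp: v_def)
qed

text \<open>Some group element has the \<open>i\<close>-th unit vector as its coordinates, and
  pairing with it reads off the \<open>i\<close>-th entry.\<close>

lemma pairing_eqD:
  assumes v: "v \<in> Rpow k" and w: "w \<in> Rpow k"
    and eq: "\<And>g. g \<in> carrier G \<Longrightarrow> pairing k v (\<psi> (proj G g)) = pairing k w (\<psi> (proj G g))"
  shows "v = w"
proof (rule PiE_ext[OF v w])
  fix i assume i: "i \<in> {..<k}"
  have "pairing k u (\<lambda>j\<in>{..<k}. if j = i then 1 else 0) = u i" for u
    unfolding pairing_def using i by (subst sum.remove[of _ i]) auto
  moreover obtain g where "g \<in> carrier G" "\<psi> (proj G g) = (\<lambda>j\<in>{..<k}. if j = i then 1 else 0)"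
    using coords_surj[of "\<lambda>j\<in>{..<k}. if j = i then 1 else 0"] by auto
  ultimately show "v i = w i"
    using eq[of g] by simp
qed

end

end

section \<open>Random walks and block counts\<close>

locale random_walk = group G for G (structure) +
  fixes \<mu> :: "'a \<Rightarrow> real"
  assumes prob: "prob_measure_on G \<mu>"
begin

abbreviation P :: "nat \<Rightarrow> 'a \<Rightarrow> real" where
  "P n \<equiv> conv_pow G \<mu> n"

lemma mu_nonneg: "g \<in> carrier G \<Longrightarrow> 0 \<le> \<mu> g"
  and mu_summable: "\<mu> summable_on carrier G"
  and mu_sum: "infsum \<mu> (carrier G) = 1"
  using prob unfolding prob_measure_on_def by (auto simp: has_sum_iff)

lemma P_nonneg: "g \<in> carrier G \<Longrightarrow> 0 \<le> P n g"
  by (induction n arbitrary: g) (auto intro: conv_nonneg mu_nonneg)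

lemma P_has_sum: "(P n has_sum 1) (carrier G)"
proof (induction n)
  case 0
  have "((\<lambda>g. 1::real) has_sum 1) {\<one>}" by (rule has_sum_finiteI) auto
  then show ?case
    by (simp, subst has_sum_cong_neutral[where T = "{\<one>}" and g = "\<lambda>_. 1"]) auto
next
  case (Suc n)
  then have "P n summable_on carrier G" "infsum (P n) (carrier G) = 1"
    by (auto simp: has_sum_iff)
  then show ?case
    using summable_conv_fun[of \<mu> "P n"] infsum_conv[of \<mu> "P n"] mu_sum mu_summable
    by (auto simp: has_sum_iff mu_nonneg P_nonneg)
qed

lemma P_summable: "P n summable_on carrier G"
  and P_sum: "infsum (P n) (carrier G) = 1"
  using P_has_sum[of n] by (auto simp: has_sum_iff)

lemma P_le_1: "g \<in> carrier G \<Longrightarrow> P n g \<le> 1"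
  using finite_sum_le_has_sum[OF P_has_sum, of "{g}" n] by (auto intro: P_nonneg)

lemma P_abs_le_1: "g \<in> carrier G \<Longrightarrow> \<bar>P n g\<bar> \<le> 1"
  using P_le_1 P_nonneg by (simp add: abs_le_iff order_trans[of _ 0])

text \<open>The Chapman-Kolmogorov relation in operator form; \<open>conv_P\<close> is its instance
  for the point mass \<open>h\<close> at the identity.\<close>

lemma conv_P_P:
  fixes h :: "'a \<Rightarrow> real"
  assumes h: "\<And>s. s \<in> carrier G \<Longrightarrow> \<bar>h s\<bar> \<le> C" and "g \<in> carrier G"
  shows "conv G (P m) (conv G (P n) h) g = conv G (P (m + n)) h g"
  using assms(2)
proof (induction m arbitrary: g)
  case 0
  then show ?case by (simp add: conv_delta_left)
next
  case (Suc m)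
  have 1: "\<bar>conv G (P n) h s\<bar> \<le> C" if "s \<in> carrier G" for s
    using conv_bounded[OF P_summable P_nonneg h that] by (simp add: P_sum)
  have "conv G (P (Suc m)) (conv G (P n) h) g = conv G \<mu> (conv G (P m) (conv G (P n) h)) g"
    using conv_assoc[OF mu_summable mu_nonneg P_summable P_nonneg 1 Suc.prems] by simp
  also have "\<dots> = conv G \<mu> (conv G (P (m + n)) h) g"
    by (intro conv_cong Suc) auto
  also have "\<dots> = conv G (P (Suc m + n)) h g"
    using conv_assoc[OF mu_summable mu_nonneg P_summable P_nonneg h Suc.prems] by simp
  finally show ?case .
qed

lemma conv_P: "g \<in> carrier G \<Longrightarrow> conv G (P m) (P n) g = P (m + n) g"
  using conv_P_P[of "\<lambda>x. if x = \<one> then 1 else 0" 1 g m n]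
  by (simp add: conv_delta_right cong: conv_cong)

lemma P_add_ge_sum:
  assumes "finite F" "F \<subseteq> carrier G" "g \<in> carrier G"
  shows "(\<Sum>s\<in>F. P m s * P n (inv s \<otimes> g)) \<le> P (m + n) g"
  using finite_sum_le_conv[where h = "P n" and C = 1, OF P_summable P_nonneg P_nonneg P_le_1 assms]
    conv_P assms by simp

lemma P_mult_le:
  assumes "x \<in> carrier G" "y \<in> carrier G"
  shows "P m x * P n y \<le> P (m + n) (x \<otimes> y)"
  using P_add_ge_sum[of "{x}" "x \<otimes> y" m n] assms by (simp add: m_assoc[symmetric])

lemma P_one: "g \<in> carrier G \<Longrightarrow> P 1 g = \<mu> g"
  by (simp add: conv_delta_right)

text \<open>
  Words of length \<open>q * N + r\<close> are cut into \<open>q\<close> blocks of length \<open>N\<close> and a rest. A word gets the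
  additional weight \<open>exp (t * K)\<close>, where \<open>K\<close> is the number of blocks whose product is \<open>x\<close>;
  \<open>tilted\<close> is the resulting total weight of the words with a given product, and \<open>block_count\<close> is
  the sum of \<open>K\<close> over them, which is the derivative of \<open>tilted\<close> at \<open>t = 0\<close>.
\<close>

definition tilted :: "nat \<Rightarrow> nat \<Rightarrow> 'a \<Rightarrow> real \<Rightarrow> nat \<Rightarrow> 'a \<Rightarrow> real" where
  "tilted N r x t q = (conv G ((P N)(x := exp t * P N x)) ^^ q) (P r)"

definition block_count :: "nat \<Rightarrow> nat \<Rightarrow> 'a \<Rightarrow> nat \<Rightarrow> 'a \<Rightarrow> real" where
  "block_count N r x q g =
     (\<Sum>j<q. conv G (P (j * N)) (\<lambda>s. P N x * P ((q - 1 - j) * N + r) (inv x \<otimes> s)) g)"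

section \<open>Block counts and exponentially weighted words\<close>

lemma P_shift_abs_le:
  assumes "x \<in> carrier G" "s \<in> carrier G"
  shows "\<bar>P N x * P n (inv x \<otimes> s)\<bar> \<le> 1"
  using assms P_le_1[of x N] P_le_1[of "inv x \<otimes> s" n]
  by (simp add: abs_mult P_nonneg mult_le_one)

lemma conv_P_shift_abs_le:
  assumes "x \<in> carrier G" "g \<in> carrier G"
  shows "\<bar>conv G (P m) (\<lambda>s. P N x * P n (inv x \<otimes> s)) g\<bar> \<le> 1"
  using conv_bounded[OF P_summable P_nonneg P_shift_abs_le[OF assms(1)] assms(2)]
  by (simp add: P_sum)

lemma block_count_abs_le:
  assumes "x \<in> carrier G" "g \<in> carrier G"
  shows "\<bar>block_count N r x q g\<bar> \<le> q"
proof -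
  have "\<bar>block_count N r x q g\<bar> \<le> (\<Sum>j<q. 1)"
    unfolding block_count_def by (intro order_trans[OF sum_abs] sum_mono conv_P_shift_abs_le assms)
  then show ?thesis by simp
qed

text \<open>Splits off the first block: the summand \<open>j = 0\<close> accounts for this block
  being \<open>x\<close>, the other summands count the blocks after it.\<close>

lemma block_count_Suc:
  assumes x: "x \<in> carrier G" and g: "g \<in> carrier G"
  shows "block_count N r x (Suc q) g =
    conv G (P N) (block_count N r x q) g + P N x * P (q * N + r) (inv x \<otimes> g)"
proof -
  have "block_count N r x (Suc q) g = P N x * P (q * N + r) (inv x \<otimes> g) +
      (\<Sum>j<q. conv G (P (N + j * N)) (\<lambda>s. P N x * P ((q - 1 - j) * N + r) (inv x \<otimes> s)) g)"
    unfolding block_count_def sum.lessThan_Suc_shift using g by (simp add: conv_delta_left)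
  also have "(\<Sum>j<q. conv G (P (N + j * N)) (\<lambda>s. P N x * P ((q - 1 - j) * N + r) (inv x \<otimes> s)) g)
      = (\<Sum>j<q. conv G (P N) (conv G (P (j * N))
          (\<lambda>s. P N x * P ((q - 1 - j) * N + r) (inv x \<otimes> s))) g)"
    by (intro sum.cong refl conv_P_P[symmetric, OF P_shift_abs_le] x g)
  also have "\<dots> = conv G (P N) (block_count N r x q) g"
    unfolding block_count_def[abs_def]
    by (intro conv_sum[symmetric, OF P_summable P_nonneg conv_P_shift_abs_le] x g) auto
  finally show ?thesis by simp
qed

text \<open>Rotating a word cyclically brings any prescribed block to its beginning.\<close>

lemma block_count_one:
  assumes x: "x \<in> carrier G"
  shows "block_count N r x q \<one> = q * P N x * P ((q - 1) * N + r) (inv x)"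
proof -
  have "conv G (P (j * N)) (\<lambda>s. P N x * P ((q - 1 - j) * N + r) (inv x \<otimes> s)) \<one>
      = P N x * P ((q - 1) * N + r) (inv x)" if "j < q" for j
  proof -
    have "(q - 1 - j) * N + r + j * N = (q - 1) * N + r"
      using that by (simp add: add.commute flip: add_mult_distrib)
    then have *: "conv G (P (j * N)) (\<lambda>s. P ((q - 1 - j) * N + r) (inv x \<otimes> s)) \<one>
        = P ((q - 1) * N + r) (inv x)"
      unfolding conv_at_inv[OF x] using conv_P[of "inv x" "(q - 1 - j) * N + r" "j * N"] x
      by (simp only: inv_closed)
    show ?thesis
      unfolding *[symmetric] unfolding conv_def
      by (simp add: mult.left_commute[of _ "P N x"] infsum_cmult_right')
  qed
  then show ?thesis
    unfolding block_count_def by simp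
qed

text \<open>Each block is a convolution with a nonnegative function of total mass
  \<open>1 + (exp t - 1) * P N x\<close>, and the rest starts from values between \<open>0\<close>
  and \<open>1\<close>.\<close>

lemma tilted_bounds:
  assumes x: "x \<in> carrier G" and g: "g \<in> carrier G"
  shows "0 \<le> tilted N r x t q g \<and> tilted N r x t q g \<le> (1 + (exp t - 1) * P N x) ^ q"
  using g
proof (induction q arbitrary: g)
  case 0
  then show ?case by (simp add: tilted_def P_nonneg P_le_1)
next
  case (Suc q)
  let ?f = "(P N)(x := exp t * P N x)"
  have f: "?f summable_on carrier G" "\<And>s. s \<in> carrier G \<Longrightarrow> 0 \<le> ?f s"
    using summable_upd[OF P_summable P_nonneg x] x P_nonneg by auto
  have "infsum ?f (carrier G) = 1 + (exp t - 1) * P N x"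
    using infsum_upd[OF P_summable P_nonneg x] by (simp add: P_sum algebra_simps)
  moreover have eq: "tilted N r x t (Suc q) = conv G ?f (tilted N r x t q)"
    by (simp add: tilted_def)
  moreover have "\<bar>tilted N r x t q s\<bar> \<le> (1 + (exp t - 1) * P N x) ^ q" if "s \<in> carrier G" for s
    using Suc.IH[OF that] by simp
  ultimately have "\<bar>tilted N r x t (Suc q) g\<bar> \<le> (1 + (exp t - 1) * P N x) ^ Suc q"
    using conv_bounded[OF f, of "tilted N r x t q" _ g] Suc.prems by (simp only: power_Suc)
  moreover have "0 \<le> tilted N r x t (Suc q) g"
    unfolding eq by (rule conv_nonneg) (use f Suc in auto)
  ultimately show ?case by simp
qed

text \<open>
  This is the bound \<open>exp u \<ge> exp w * (1 - w + u)\<close> for \<open>u = t * K\<close>, summed over all words.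
\<close>

lemma tilted_ge:
  assumes x: "x \<in> carrier G" and g: "g \<in> carrier G"
  shows "exp w * ((1 - w) * P (q * N + r) g + t * block_count N r x q g) \<le> tilted N r x t q g"
  using g
proof (induction q arbitrary: g w)
  case 0
  have "exp w * (1 - w) \<le> exp w * exp (- w)"
    using exp_ge_add_one_self[of "- w"] by (intro mult_left_mono) auto
  then have "exp w * (1 - w) \<le> 1" by (simp flip: exp_add)
  from mult_right_mono[OF this P_nonneg[OF 0]] show ?case
    by (simp add: tilted_def block_count_def mult.assoc)
next
  case (Suc q)
  \<comment> \<open>\<open>\<rho>\<close> carries the blocks with product other than
    \<open>x\<close>; the atom at \<open>x\<close> has weight \<open>P N x\<close> untilted and
    \<open>exp t * P N x\<close> tilted.\<close>
  define \<rho> where "\<rho> = (P N)(x := 0)"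
  let ?\<alpha> = "P N x" and ?E = "tilted N r x t q" and ?Z = "P (q * N + r)" and ?D = "block_count N r x q"
  have xg: "inv x \<otimes> g \<in> carrier G" using x Suc.prems by simp
  have \<rho>: "\<rho> summable_on carrier G" "\<And>s. s \<in> carrier G \<Longrightarrow> 0 \<le> \<rho> s"
    unfolding \<rho>_def using summable_upd[OF P_summable P_nonneg x] P_nonneg by auto
  have split: "conv G ((P N)(x := c)) h g = conv G \<rho> h g + c * h (inv x \<otimes> g)"
    if "\<And>s. s \<in> carrier G \<Longrightarrow> \<bar>h s\<bar> \<le> C" for c C h
    using conv_upd[of \<rho> x h C g c] \<rho> x that Suc.prems
    unfolding \<rho>_def fun_upd_upd by simp
  have bE: "\<bar>?E s\<bar> \<le> (1 + (exp t - 1) * ?\<alpha>) ^ q" if "s \<in> carrier G" for s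
    using tilted_bounds[OF x that, of N r t q] by simp
  have bZ: "\<bar>?Z s\<bar> \<le> 1" if "s \<in> carrier G" for s
    using P_abs_le_1[OF that] .
  have bD: "\<bar>?D s\<bar> \<le> q" if "s \<in> carrier G" for s
    using block_count_abs_le[OF x that] .
  have Z: "P (Suc q * N + r) g = conv G \<rho> ?Z g + ?\<alpha> * ?Z (inv x \<otimes> g)"
    using split[OF bZ, where c = ?\<alpha>] conv_P[OF Suc.prems, of N "q * N + r"] by (simp add: add.assoc)
  have D: "block_count N r x (Suc q) g
      = conv G \<rho> ?D g + ?\<alpha> * ?D (inv x \<otimes> g) + ?\<alpha> * ?Z (inv x \<otimes> g)"
    using split[OF bD, where c = ?\<alpha>] block_count_Suc[OF x Suc.prems, of N r q] by simp
  have E: "tilted N r x t (Suc q) g = conv G \<rho> ?E g + exp t * ?\<alpha> * ?E (inv x \<otimes> g)"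
    using split[OF bE, where c = "exp t * ?\<alpha>"] by (simp add: tilted_def)
  have b: "\<bar>exp w * (1 - w) * ?Z s + exp w * t * ?D s\<bar> \<le> \<bar>exp w * (1 - w)\<bar> * 1 + \<bar>exp w * t\<bar> * q"
    if "s \<in> carrier G" for s
    using bZ[OF that] bD[OF that]
    by (intro order_trans[OF abs_triangle_ineq] add_mono) (auto simp: abs_mult intro!: mult_left_mono mult_left_le)
  have "conv G \<rho> (\<lambda>s. exp w * (1 - w) * ?Z s + exp w * t * ?D s) g \<le> conv G \<rho> ?E g"
    using Suc.IH by (intro conv_mono[OF \<rho> b bE _ Suc.prems]) (auto simp: algebra_simps)
  then have 1: "exp w * (1 - w) * conv G \<rho> ?Z g + exp w * t * conv G \<rho> ?D g \<le> conv G \<rho> ?E g"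
    by (subst (asm) conv_add[OF \<rho> bZ bD Suc.prems])
  \<comment> \<open>A first block equal to \<open>x\<close> already contributes \<open>t\<close> to
    the exponent, so the induction hypothesis is used at \<open>w - t\<close>; the factor
    \<open>exp t\<close> restores \<open>exp w\<close>.\<close>
  have "exp t * ?\<alpha> * (exp (w - t) * ((1 - (w - t)) * ?Z (inv x \<otimes> g) + t * ?D (inv x \<otimes> g)))
      \<le> exp t * ?\<alpha> * ?E (inv x \<otimes> g)"
    by (intro mult_left_mono Suc.IH xg) (simp add: P_nonneg x)
  moreover have "exp t * (?\<alpha> * (exp (w - t) * y)) = exp w * (?\<alpha> * y)" for y
    by (simp add: exp_diff)
  ultimately have 2: "exp w * (?\<alpha> * ((1 - (w - t)) * ?Z (inv x \<otimes> g) + t * ?D (inv x \<otimes> g)))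
      \<le> exp t * ?\<alpha> * ?E (inv x \<otimes> g)"
    by (simp only: mult.assoc)
  show ?case
    using add_mono[OF 1 2] unfolding Z D E by (simp add: algebra_simps)
qed

text \<open>Compares the lower and upper bounds for \<open>tilted\<close> at the identity, then
  takes logarithms and divides by \<open>q * P N x\<close>.\<close>

lemma ratio_bound:
  assumes x: "x \<in> carrier G" and pos: "0 < P N x" "0 < P (q * N + r) \<one>" and q: "0 < q"
  shows "t * (P ((q - 1) * N + r) (inv x) / P (q * N + r) \<one>)
    \<le> exp t - 1 - ln (P (q * N + r) \<one>) / (q * P N x)"
proof -
  let ?Z = "P (q * N + r) \<one>" and ?\<alpha> = "P N x" and ?D = "block_count N r x q \<one>"
  \<comment> \<open>\<open>w\<close> is the mean of \<open>t * K\<close> over the closed words. At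
    this value the linear terms cancel and \<open>tilted_ge\<close> becomes Jensen's
    inequality.\<close>
  define w where "w = t * ?D / ?Z"
  have "exp w * ?Z = exp w * ((1 - w) * ?Z + t * ?D)"
    using pos by (simp add: w_def field_simps)
  also have "\<dots> \<le> (1 + (exp t - 1) * ?\<alpha>) ^ q"
    using tilted_ge[OF x one_closed, of w q N r t] tilted_bounds[OF x one_closed, of N r t q] by simp
  also have "\<dots> \<le> exp ((exp t - 1) * ?\<alpha>) ^ q"
  proof (rule power_mono)
    have "0 \<le> exp t * ?\<alpha>" "?\<alpha> \<le> 1" using pos P_le_1[OF x] by auto
    then show "0 \<le> 1 + (exp t - 1) * ?\<alpha>" by (simp add: left_diff_distrib)
  qed (rule exp_ge_add_one_self)
  finally have "exp (w + ln ?Z) \<le> exp (q * ((exp t - 1) * ?\<alpha>))"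
    using pos by (simp add: exp_add exp_of_nat_mult)
  then have "w + ln ?Z \<le> q * ((exp t - 1) * ?\<alpha>)" by simp
  then have "w / (q * ?\<alpha>) \<le> (q * ((exp t - 1) * ?\<alpha>) - ln ?Z) / (q * ?\<alpha>)"
    using pos q by (intro divide_right_mono) auto
  also have "\<dots> = exp t - 1 - ln ?Z / (q * ?\<alpha>)"
    using pos q by (simp add: diff_divide_distrib)
  also have "w / (q * ?\<alpha>) = t * (P ((q - 1) * N + r) (inv x) / ?Z)"
    using pos q unfolding w_def block_count_one[OF x] by simp
  finally show ?thesis .
qed

text \<open>Uses \<open>ratio_bound\<close> at \<open>t = e\<close> and \<open>t = - e\<close>. Both
  errors are of order \<open>e * e\<close>, so dividing by \<open>e\<close> leaves at most
  \<open>2 * e\<close> on either side.\<close>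

lemma shifted_ratio_tendsto:
  assumes x: "x \<in> carrier G" and pos: "0 < P N x" and N: "0 < N"
    and ev: "eventually (\<lambda>n. 0 < P n \<one>) sequentially"
    and lim: "(\<lambda>n. ln (P n \<one>) / n) \<longlonglongrightarrow> 0"
  shows "(\<lambda>n. P (n - N) (inv x) / P n \<one>) \<longlonglongrightarrow> 1"
proof -
  let ?R = "\<lambda>n. P (n - N) (inv x) / P n \<one>"
  have main: "eventually (\<lambda>n. \<bar>?R n - 1\<bar> \<le> 2 * e) sequentially" if e: "0 < e" "e < 1" for e :: real
  proof -
    \<comment> \<open>The threshold is chosen so that, because \<open>n \<le> 2 * N * q\<close> once
      \<open>n \<ge> N\<close>, the logarithmic error \<open>\<delta>\<close> is at most
      \<open>e * e\<close>.\<close>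
    have "eventually (\<lambda>n. - (ln (P n \<one>) / n) < e\<^sup>2 * P N x / (2 * N)) sequentially"
      using e pos N by (intro order_tendstoD(2)[OF tendsto_minus[OF lim]]) auto
    with ev eventually_ge_at_top[of N] show ?thesis
    proof eventually_elim
      case (elim n)
      define q r where "q = n div N" and "r = n mod N"
      have n: "n = q * N + r" by (simp add: q_def r_def)
      have q: "0 < q" using elim N by (simp add: q_def div_greater_zero_iff)
      have "r < N" using N by (simp add: r_def)
      moreover have "N \<le> q * N" using q by simp
      ultimately have "n \<le> 2 * (q * N)" using n by linarith
      then have "n \<le> 2 * N * q" by (simp add: ac_simps)
      then have nq: "real n \<le> 2 * N * q" by (metis of_nat_le_iff of_nat_mult of_nat_numeral)
      have sub: "(q - 1) * N + r = n - N"
        using n q by (simp add: diff_mult_distrib)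
      have "0 \<le> - ln (P n \<one>)" using elim P_le_1[of \<one> n] by simp
      define \<delta> where "\<delta> = - ln (P n \<one>) / (q * P N x)"
      have "- ln (P n \<one>) < e\<^sup>2 * P N x / (2 * N) * n"
        using elim N by (simp add: field_simps)
      also have "\<dots> \<le> e\<^sup>2 * P N x / (2 * N) * (2 * N * q)"
        using nq pos by (intro mult_left_mono) auto
      also have "\<dots> = e\<^sup>2 * (q * P N x)" using N by simp
      finally have \<delta>: "\<delta> \<le> e * e"
        unfolding \<delta>_def using pos q by (simp add: divide_simps power2_eq_square)
      have bound: "t * ?R n \<le> exp t - 1 + \<delta>" for t
        using ratio_bound[OF x pos _ q, of r t] elim by (simp add: \<delta>_def flip: n sub)
      \<comment> \<open>Here \<open>exp e \<le> 1 + e + e * e\<close>; below,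
        \<open>exp (- e) \<le> 1 / (1 + e) \<le> 1 - e + e * e\<close>. The error
        \<open>\<delta>\<close> contributes the second \<open>e * e\<close>.\<close>
      have "e * ?R n \<le> e * (1 + 2 * e)"
        using bound[of e] exp_bound[of e] e \<delta> by (simp add: power2_eq_square algebra_simps)
      then have 1: "?R n \<le> 1 + 2 * e" using e by (subst (asm) mult_le_cancel_left_pos) auto
      have "exp (- e) \<le> 1 / (1 + e)"
        using exp_ge_add_one_self[of e] e by (simp add: exp_minus divide_simps)
      also have "\<dots> \<le> 1 - e + e * e"
        using e by (simp add: divide_simps algebra_simps)
      finally have "e * (1 - 2 * e) \<le> e * ?R n"
        using bound[of "- e"] \<delta> by (simp add: algebra_simps)
      then have 2: "1 - 2 * e \<le> ?R n" using e by (subst (asm) mult_le_cancel_left_pos) auto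
      from 1 2 show ?case by (simp add: abs_le_iff)
    qed
  qed
  show ?thesis
  proof (rule tendstoI)
    fix e :: real assume "0 < e"
    define d where "d = min (e / 3) (1 / 2)"
    have d: "0 < d" "d < 1" "2 * d < e" using \<open>0 < e\<close> by (auto simp: d_def min_def)
    from main[OF d(1,2)] show "eventually (\<lambda>n. dist (?R n) 1 < e) sequentially"
      by eventually_elim (use d in \<open>auto simp: dist_real_def\<close>)
  qed
qed

text \<open>Dividing the shifted limit for \<open>x\<close> by the one for \<open>\<one>\<close>
  cancels \<open>P n \<one>\<close> and leaves both lengths equal to \<open>n - N\<close>;
  re-indexing removes the shift.\<close>

theorem ratio_tendsto_1:
  assumes x: "x \<in> carrier G" and pos: "0 < P N x" "0 < P N \<one>" and N: "0 < N"
    and ev: "eventually (\<lambda>n. 0 < P n \<one>) sequentially"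
    and lim: "(\<lambda>n. ln (P n \<one>) / n) \<longlonglongrightarrow> 0"
  shows "(\<lambda>n. P n (inv x) / P n \<one>) \<longlonglongrightarrow> 1"
proof -
  have "(\<lambda>n. (P (n - N) (inv x) / P n \<one>) / (P (n - N) (inv \<one>) / P n \<one>)) \<longlonglongrightarrow> 1 / 1"
    by (intro tendsto_divide shifted_ratio_tendsto x pos N ev lim) auto
  then have "(\<lambda>n. (P (n + N - N) (inv x) / P (n + N) \<one>) / (P (n + N - N) (inv \<one>) / P (n + N) \<one>))
      \<longlonglongrightarrow> 1"
    by (intro LIMSEQ_ignore_initial_segment[where k = N]) simp
  moreover have "eventually (\<lambda>n. (P (n + N - N) (inv x) / P (n + N) \<one>) / (P (n + N - N) (inv \<one>) / P (n + N) \<one>)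
      = P n (inv x) / P n \<one>) sequentially"
    \<comment> \<open>Positivity is needed at both \<open>n\<close> and
      \<open>n + N\<close>.\<close>
    using eventually_all_ge_at_top[OF ev]
  proof eventually_elim
    case (elim n)
    then have "0 < P n \<one>" "0 < P (n + N) \<one>" by auto
    then show ?case by simp
  qed
  ultimately show ?thesis
    by (rule Lim_transform_eventually)
qed

end

section \<open>The ratio limit\<close>

text \<open>Fekete's argument: \<open>\<Lambda>\<close> is the supremum of the roots over
  \<open>n > 0\<close>, and repeating a nearly optimal \<open>p\<close> bounds \<open>a n\<close>
  from below for all large \<open>n\<close>.\<close>

lemma supermultiplicative_root:
  fixes a :: "nat \<Rightarrow> real"
  assumes nonneg: "\<And>n. 0 \<le> a n" and le1: "\<And>n. a n \<le> 1"
    and super: "\<And>m n. a m * a n \<le> a (m + n)" and pos: "\<And>n. n0 \<le> n \<Longrightarrow> 0 < a n"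
  obtains \<Lambda> where "0 < \<Lambda>" "\<And>n. a n \<le> \<Lambda> ^ n" "(\<lambda>n. root n (a n)) \<longlonglongrightarrow> \<Lambda>"
proof
  let ?r = "\<lambda>n. root n (a n)"
  define \<Lambda> where "\<Lambda> = Sup (?r ` {0<..})"
  have r1: "?r n \<le> 1" if "0 < n" for n
    using real_root_le_mono[OF that le1[of n]] that by simp
  have bdd: "bdd_above (?r ` {0<..})"
    using r1 by (intro bdd_aboveI[of _ 1]) auto
  have le: "?r n \<le> \<Lambda>" if "0 < n" for n
    unfolding \<Lambda>_def using that by (intro cSup_upper bdd) auto
  have "0 < ?r (Suc n0)" using pos[of "Suc n0"] by simp
  then show \<Lambda>: "0 < \<Lambda>" using le[of "Suc n0"] by (rule less_le_trans) simp
  have "\<Lambda> \<le> 1" unfolding \<Lambda>_def by (rule cSup_least) (use r1 in auto)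
  show "a n \<le> \<Lambda> ^ n" for n
  proof (cases "n = 0")
    case False
    then have "?r n ^ n = a n" using nonneg by simp
    moreover have "?r n ^ n \<le> \<Lambda> ^ n"
      using le[of n] False nonneg by (intro power_mono) auto
    ultimately show ?thesis by simp
  qed (use le1 in simp)
  have powers: "a p ^ q * a r \<le> a (q * p + r)" for p q r
  proof (induction q)
    case (Suc q)
    have "a p ^ Suc q * a r = a p * (a p ^ q * a r)" by simp
    also have "\<dots> \<le> a p * a (q * p + r)" by (intro mult_left_mono Suc nonneg)
    also have "\<dots> \<le> a (Suc q * p + r)" using super[of p "q * p + r"] by (simp add: add.assoc)
    finally show ?case .
  qed simp
  show "?r \<longlonglongrightarrow> \<Lambda>"
  proof (rule order_tendstoI)
    fix y assume "\<Lambda> < y"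
    show "eventually (\<lambda>n. ?r n < y) sequentially"
      using eventually_gt_at_top[of 0] by eventually_elim (rule le_less_trans[OF le \<open>\<Lambda> < y\<close>])
  next
    fix y assume "y < \<Lambda>"
    then obtain c where c: "max y 0 < c" "c < \<Lambda>"
      using dense[of "max y 0" \<Lambda>] \<Lambda> by auto
    then obtain p where p: "0 < p" "c < ?r p"
      unfolding \<Lambda>_def by (auto elim: less_cSupE)
    have cp: "c ^ p \<le> a p"
    proof -
      have "c ^ p \<le> ?r p ^ p" using p c by (intro power_mono) auto
      then show ?thesis using p nonneg by simp
    qed
    \<comment> \<open>Every \<open>n \<ge> n0\<close> is \<open>q * p + r\<close> with
      \<open>r\<close> in this window of length \<open>p\<close>, on which \<open>a\<close> is
      positive.\<close>
    define \<kappa> where "\<kappa> = Min (a ` {n0..<n0 + p})"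
    have \<kappa>: "0 < \<kappa>" unfolding \<kappa>_def using p pos by (subst Min_gr_iff) auto
    have low: "c * root n \<kappa> \<le> ?r n" if n: "max n0 1 \<le> n" for n
    proof -
      define q r where "q = (n - n0) div p" and "r = n0 + (n - n0) mod p"
      have nqr: "n = q * p + r" using n by (simp add: q_def r_def)
      have "\<kappa> \<le> a r" unfolding \<kappa>_def r_def using p by (intro Min_le) auto
      \<comment> \<open>Since \<open>c < \<Lambda> \<le> 1\<close> and \<open>p * q \<le> n\<close>,
        lowering the exponent cannot decrease the power.\<close>
      have "c ^ n \<le> (c ^ p) ^ q"
        unfolding power_mult[symmetric] using c \<open>\<Lambda> \<le> 1\<close> nqr
        by (intro power_decreasing) (auto simp: mult.commute)
      also have "\<dots> \<le> a p ^ q" using cp c by (intro power_mono) auto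
      finally have "c ^ n * \<kappa> \<le> a p ^ q * a r"
        using \<open>\<kappa> \<le> a r\<close> \<kappa> nonneg by (intro mult_mono) auto
      also have "\<dots> \<le> a n" using powers nqr by simp
      finally have "root n (c ^ n * \<kappa>) \<le> ?r n"
        using n by (intro real_root_le_mono) auto
      moreover have "root n (c ^ n * \<kappa>) = c * root n \<kappa>"
        using n c by (simp add: real_root_mult real_root_power_cancel)
      ultimately show ?thesis by simp
    qed
    have "(\<lambda>n. c * root n \<kappa>) \<longlonglongrightarrow> c * 1"
      by (intro tendsto_mult tendsto_const LIMSEQ_root_const \<kappa>)
    then have "eventually (\<lambda>n. y < c * root n \<kappa>) sequentially"
      using c by (intro order_tendstoD(1)) auto
    with eventually_ge_at_top[of "max n0 1"] show "eventually (\<lambda>n. y < ?r n) sequentially"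
      by eventually_elim (rule less_le_trans[OF _ low])
  qed
qed

section \<open>Positivity and change of measure\<close>

context random_walk
begin

lemma generated_P_pos:
  assumes "g \<in> semigroup_generated G (supp G \<mu>)"
  shows "g \<in> carrier G \<and> (\<exists>n>0. 0 < P n g)"
  using assms
proof induction
  case (incl s)
  then have "0 < P 1 s" "s \<in> carrier G" by (auto simp: supp_def conv_delta_right)
  then show ?case by (auto intro!: exI[of _ 1])
next
  case (mult a b)
  then obtain m n where mn: "0 < m" "0 < P m a" "0 < P n b" by auto
  then have "0 < P m a * P n b" by simp
  also have "\<dots> \<le> P (m + n) (a \<otimes> b)" using mult by (intro P_mult_le) auto
  finally show ?case using mult mn by (auto intro!: exI[of _ "m + n"])
qed

lemma P_pos:
  assumes "non_degenerate G \<mu>" "g \<in> carrier G"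
  obtains n where "0 < n" "0 < P n g"
  using generated_P_pos[of g] assms unfolding non_degenerate_def by auto

context
  fixes L :: "'a \<Rightarrow> real" and c :: real
  assumes L: "\<And>x y. \<lbrakk>x \<in> carrier G; y \<in> carrier G\<rbrakk> \<Longrightarrow> L (x \<otimes> y) = L x + L y"
    and c: "0 < c" "((\<lambda>g. exp (L g) * \<mu> g) has_sum c) (carrier G)"
begin

lemma twist_random_walk: "random_walk G (\<lambda>g. exp (L g) * \<mu> g / c)"
proof
  have "((\<lambda>g. exp (L g) * \<mu> g * (1 / c)) has_sum c * (1 / c)) (carrier G)"
    by (rule has_sum_cmult_left) (fact c)
  then show "prob_measure_on G (\<lambda>g. exp (L g) * \<mu> g / c)"
    using c mu_nonneg by (auto simp: prob_measure_on_def)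
qed

text \<open>Since \<open>L s + L (inv s \<otimes> g) = L g\<close>, the factor
  \<open>exp (L g)\<close> comes out of each convolution sum.\<close>

lemma twist_conv_pow:
  "g \<in> carrier G \<Longrightarrow> conv_pow G (\<lambda>g. exp (L g) * \<mu> g / c) n g = exp (L g) * P n g / c ^ n"
proof (induction n arbitrary: g)
  case 0
  then show ?case by (simp add: additive_one[OF L])
next
  case (Suc n)
  have eq: "exp (L s) * \<mu> s / c * conv_pow G (\<lambda>g. exp (L g) * \<mu> g / c) n (inv s \<otimes> g)
      = exp (L g) / c ^ Suc n * (\<mu> s * P n (inv s \<otimes> g))" if s: "s \<in> carrier G" for s
  proof -
    have "exp (L s) * exp (L (inv s \<otimes> g)) = exp (L g)"
      using L[of s "inv s \<otimes> g"] s Suc.prems by (simp flip: exp_add)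
    then show ?thesis using Suc.IH[of "inv s \<otimes> g"] Suc.prems s by (simp add: mult_ac)
  qed
  have "conv_pow G (\<lambda>g. exp (L g) * \<mu> g / c) (Suc n) g
      = (\<Sum>\<^sub>\<infinity>s\<in>carrier G. exp (L g) / c ^ Suc n * (\<mu> s * P n (inv s \<otimes> g)))"
    by (simp only: conv_pow.simps conv_def[of G "\<lambda>g. exp (L g) * \<mu> g / c"] eq cong: infsum_cong)
  also have "\<dots> = exp (L g) / c ^ Suc n * conv G \<mu> (P n) g"
    unfolding conv_def by (rule infsum_cmult_right')
  finally show ?case by simp
qed

text \<open>The return probabilities of the normalised twisted walk are at most \<open>1\<close>,
  and \<open>L \<one> = 0\<close>.\<close>

lemma P_one_le_power: "P n \<one> \<le> c ^ n"
proof -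
  interpret W: random_walk G "\<lambda>g. exp (L g) * \<mu> g / c" by (rule twist_random_walk)
  show ?thesis
    using W.P_le_1[of \<one> n] twist_conv_pow[of \<one> n] c by (simp add: additive_one[OF L] divide_simps)
qed

text \<open>Twisting divides the return probabilities by \<open>c ^ n\<close>, which removes their
  exponential decay, so \<open>ratio_tendsto_1\<close> applies. The twisted ratios are
  \<open>exp (L g)\<close> times the original ones.\<close>

theorem ratio_tendsto:
  assumes nd: "non_degenerate G \<mu>" and pos: "\<And>n. n0 \<le> n \<Longrightarrow> 0 < P n \<one>"
    and root: "(\<lambda>n. root n (P n \<one>)) \<longlonglongrightarrow> c"
    and g: "g \<in> carrier G"
  shows "(\<lambda>n. P n g / P n \<one>) \<longlonglongrightarrow> exp (- L g)"
proof -
  interpret W: random_walk G "\<lambda>g. exp (L g) * \<mu> g / c" by (rule twist_random_walk)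
  obtain j where j: "0 < j" "0 < P j (inv g)"
    using P_pos[OF nd] g by blast
  have ev: "eventually (\<lambda>n. n0 \<le> n \<and> 0 < n) sequentially"
    by (intro eventually_conj eventually_ge_at_top eventually_gt_at_top)
  \<comment> \<open>The length \<open>j + n0\<close> serves both points: a word for
    \<open>inv g\<close> is completed by a closed word of length \<open>n0\<close>, and closed words
    exist at every length from \<open>n0\<close> on.\<close>
  have "0 < P j (inv g) * P n0 \<one>" using j pos by simp
  also have "\<dots> \<le> P (j + n0) (inv g)" using P_mult_le[of "inv g" \<one> j n0] g by simp
  finally have N: "0 < P (j + n0) (inv g)" .
  have "(\<lambda>n. W.P n (inv (inv g)) / W.P n \<one>) \<longlonglongrightarrow> 1"
  proof (rule W.ratio_tendsto_1)
    show "0 < W.P (j + n0) (inv g)" "0 < W.P (j + n0) \<one>"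
      using N pos c g by (simp_all add: twist_conv_pow)
    show "eventually (\<lambda>n. 0 < W.P n \<one>) sequentially"
      using ev by eventually_elim (use pos c in \<open>simp add: twist_conv_pow\<close>)
    have "(\<lambda>n. ln (root n (P n \<one>)) - ln c) \<longlonglongrightarrow> ln c - ln c"
      using c by (intro tendsto_diff tendsto_ln root tendsto_const) simp
    moreover have "eventually (\<lambda>n. ln (root n (P n \<one>)) - ln c = ln (W.P n \<one>) / n) sequentially"
      using ev
    proof eventually_elim
      case (elim n)
      then have "ln (W.P n \<one>) = ln (P n \<one>) - n * ln c"
        using pos[of n] c by (simp add: twist_conv_pow additive_one[OF L] ln_div ln_realpow)
      then show ?case
        using elim pos by (simp add: ln_root diff_divide_distrib)
    qed
    ultimately show "(\<lambda>n. ln (W.P n \<one>) / n) \<longlonglongrightarrow> 0"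
      by (simp add: Lim_transform_eventually)
  qed (use j g in auto)
  then have "(\<lambda>n. exp (- L g) * (W.P n g / W.P n \<one>)) \<longlonglongrightarrow> exp (- L g) * 1"
    using g by (intro tendsto_mult tendsto_const) simp
  moreover have "exp (- L g) * (W.P n g / W.P n \<one>) = P n g / P n \<one>" for n
    using c g by (simp add: twist_conv_pow additive_one[OF L] exp_minus)
  ultimately show ?thesis by simp
qed

end

end

section \<open>Amenability\<close>

context group
begin

lemma linf_const: "(\<lambda>x. c) \<in> linf G"
  by (auto simp: linf_def bounded_iff)

lemma linfI: "(\<And>x. x \<in> carrier G \<Longrightarrow> \<bar>f x\<bar> \<le> C) \<Longrightarrow> f \<in> linf G"
  by (auto simp: linf_def bounded_iff)

lemma linf_add: "f \<in> linf G \<Longrightarrow> h \<in> linf G \<Longrightarrow> (\<lambda>x. f x + h x) \<in> linf G"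
  unfolding linf_def by (auto intro: bounded_plus_comp)

lemma linf_cmult: "f \<in> linf G \<Longrightarrow> (\<lambda>x. a * f x) \<in> linf G" for a :: real
  unfolding linf_def
  using bounded_scaling[of "f ` carrier G" a] by (simp add: image_image)

lemma linf_translate: "f \<in> linf G \<Longrightarrow> s \<in> carrier G \<Longrightarrow> (\<lambda>x. f (s \<otimes> x)) \<in> linf G"
  unfolding linf_def by (auto elim!: bounded_subset)

lemma linf_sum:
  assumes "finite F" "\<And>s. s \<in> F \<Longrightarrow> u s \<in> linf G"
  shows "(\<lambda>x. \<Sum>s\<in>F. a s * u s x) \<in> linf G"
  using assms by (induction F) (auto intro!: linf_add linf_cmult linf_const)

context
  fixes m assumes m: "is_mean G m"
begin

lemma mean_add: "f \<in> linf G \<Longrightarrow> h \<in> linf G \<Longrightarrow> m (\<lambda>x. f x + h x) = m f + m h"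
  and mean_cmult: "f \<in> linf G \<Longrightarrow> m (\<lambda>x. a * f x) = a * m f"
  and mean_nonneg: "f \<in> linf G \<Longrightarrow> (\<And>x. x \<in> carrier G \<Longrightarrow> 0 \<le> f x) \<Longrightarrow> 0 \<le> m f"
  and mean_one: "m (\<lambda>x. 1) = 1"
  using m unfolding is_mean_def by auto

lemma mean_const: "m (\<lambda>x. c) = c"
  using mean_cmult[OF linf_const, of c 1] by (simp add: mean_one)

lemma mean_mono:
  assumes "f \<in> linf G" "h \<in> linf G" "\<And>x. x \<in> carrier G \<Longrightarrow> f x \<le> h x"
  shows "m f \<le> m h"
proof -
  have "0 \<le> m (\<lambda>x. h x + - 1 * f x)"
    using assms by (intro mean_nonneg linf_add linf_cmult) auto
  also have "\<dots> = m h - m f"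
    unfolding mean_add[OF assms(2) linf_cmult[OF assms(1)]] mean_cmult[OF assms(1)] by simp
  finally show ?thesis by simp
qed

lemma mean_sum:
  assumes "finite F" "\<And>s. s \<in> F \<Longrightarrow> u s \<in> linf G"
  shows "m (\<lambda>x. \<Sum>s\<in>F. a s * u s x) = (\<Sum>s\<in>F. a s * m (u s))"
  using assms
  by (induction F) (simp_all add: mean_const mean_add mean_cmult linf_cmult linf_sum)

end

end

section \<open>Real-valued homomorphisms from an invariant mean\<close>

context random_walk
begin

text \<open>The strict inequality \<open>\<Lambda> < c\<close> makes the Green function converge.
  The pointwise bound on \<open>L\<close> prepares the compactness argument in
  \<open>exists_character\<close>.\<close>

lemma exists_character_above:
  assumes m: "is_mean G m" "translation_invariant G m"
    and \<Lambda>: "\<And>n. P n \<one> \<le> \<Lambda> ^ n" "0 < \<Lambda>" and c: "\<Lambda> < c"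
    and J: "\<And>g. g \<in> carrier G \<Longrightarrow> 0 < P (J g) g"
  obtains L where "\<And>x y. \<lbrakk>x \<in> carrier G; y \<in> carrier G\<rbrakk> \<Longrightarrow> L (x \<otimes> y) = L x + L y"
    and "\<And>g. g \<in> carrier G \<Longrightarrow> L g \<le> J g * ln c - ln (P (J g) g)"
    and "\<And>F. \<lbrakk>finite F; F \<subseteq> carrier G\<rbrakk> \<Longrightarrow> (\<Sum>s\<in>F. \<mu> s * exp (L s)) \<le> c"
proof
  have c0: "0 < c" using \<Lambda> c by simp
  define f where "f = (\<lambda>g. \<Sum>n. P n g / c ^ n)"
  have summable: "summable (\<lambda>n. P n g / c ^ n)" if g: "g \<in> carrier G" for g
  proof (rule summable_comparison_test)
    let ?j = "J (inv g)" let ?p = "P ?j (inv g)"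
    have p: "0 < ?p" using J g by simp
    \<comment> \<open>Continuing a word for \<open>g\<close> by one for \<open>inv g\<close> gives a
      closed word, so \<open>P n g\<close> is at most a constant times
      \<open>\<Lambda> ^ n\<close>.\<close>
    have "norm (P n g / c ^ n) \<le> \<Lambda> ^ ?j / ?p * (\<Lambda> / c) ^ n" for n
    proof -
      have "P n g * ?p \<le> P (n + ?j) \<one>"
        using P_mult_le[of g "inv g" n ?j] g by simp
      also have "\<dots> \<le> \<Lambda> ^ (n + ?j)" by (rule \<Lambda>)
      finally have "P n g \<le> \<Lambda> ^ ?j / ?p * \<Lambda> ^ n"
        using p by (simp add: pos_le_divide_eq power_add mult.commute)
      then have "P n g / c ^ n \<le> \<Lambda> ^ ?j / ?p * \<Lambda> ^ n / c ^ n"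
        using c0 by (intro divide_right_mono) auto
      then show ?thesis
        using c0 P_nonneg[OF g] by (simp add: power_divide)
    qed
    then show "\<exists>N. \<forall>n\<ge>N. norm (P n g / c ^ n) \<le> \<Lambda> ^ ?j / ?p * (\<Lambda> / c) ^ n" by blast
    show "summable (\<lambda>n. \<Lambda> ^ ?j / ?p * (\<Lambda> / c) ^ n)"
      using c \<Lambda> c0 by (intro summable_mult summable_geometric) simp
  qed
  have f_pos: "0 < f g" if g: "g \<in> carrier G" for g
    unfolding f_def
    by (rule suminf_pos2[OF summable[OF g], of "J g"]) (use c0 J P_nonneg g in auto)
  \<comment> \<open>Convolving with \<open>P j\<close> shifts the Green series by \<open>j\<close>
    terms and multiplies it by \<open>c ^ j\<close>; the \<open>j\<close> terms lost are
    nonnegative.\<close>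
  have super: "(\<Sum>s\<in>F. P j s * f (inv s \<otimes> g)) \<le> c ^ j * f g"
    if F: "finite F" "F \<subseteq> carrier G" and g: "g \<in> carrier G" for F j g
  proof -
    have in_G: "inv s \<otimes> g \<in> carrier G" if "s \<in> F" for s using F g that by auto
    have "(\<Sum>s\<in>F. P j s * f (inv s \<otimes> g)) = (\<Sum>n. \<Sum>s\<in>F. P j s * (P n (inv s \<otimes> g) / c ^ n))"
      unfolding f_def using summable in_G
      by (subst suminf_sum)
        (auto simp del: times_divide_eq_right intro!: summable_mult sum.cong suminf_mult[symmetric])
    also have "\<dots> \<le> (\<Sum>n. c ^ j * (P (n + j) g / c ^ (n + j)))"
    proof (rule suminf_le)
      fix n
      have "(\<Sum>s\<in>F. P j s * (P n (inv s \<otimes> g) / c ^ n)) = (\<Sum>s\<in>F. P j s * P n (inv s \<otimes> g)) / c ^ n"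
        by (simp add: sum_divide_distrib)
      also have "\<dots> \<le> P (j + n) g / c ^ n"
        using P_add_ge_sum[OF F g] c0 by (intro divide_right_mono) auto
      finally show "(\<Sum>s\<in>F. P j s * (P n (inv s \<otimes> g) / c ^ n)) \<le> c ^ j * (P (n + j) g / c ^ (n + j))"
        using c0 by (simp add: power_add add.commute)
    next
      show "summable (\<lambda>n. \<Sum>s\<in>F. P j s * (P n (inv s \<otimes> g) / c ^ n))"
        using summable in_G by (intro summable_sum summable_mult) auto
      show "summable (\<lambda>n. c ^ j * (P (n + j) g / c ^ (n + j)))"
        by (intro summable_mult summable_ignore_initial_segment summable g)
    qed
    also have "\<dots> = c ^ j * (\<Sum>n. P (n + j) g / c ^ (n + j))"
      by (intro suminf_mult summable_ignore_initial_segment[where f = "\<lambda>n. P n g / c ^ n"] summable g)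
    also have "(\<Sum>n. P (n + j) g / c ^ (n + j)) \<le> f g"
      unfolding f_def suminf_minus_initial_segment[OF summable[OF g], of j]
      using c0 P_nonneg[OF g] by (auto intro!: sum_nonneg)
    finally show ?thesis using c0 by simp
  qed
  define u where "u = (\<lambda>s g. ln (f (inv s \<otimes> g)) - ln (f g))"
  define L where "L = (\<lambda>s. m (u s))"
  \<comment> \<open>A Harnack inequality, from \<open>super\<close> with the single element
    \<open>s\<close> and length \<open>J s\<close>. Applied to \<open>inv s\<close> it also bounds
    \<open>u s\<close> from below.\<close>
  have u_le: "u s g \<le> J s * ln c - ln (P (J s) s)" if s: "s \<in> carrier G" and g: "g \<in> carrier G" for s g
  proof -
    have pos: "0 < f (inv s \<otimes> g)" "0 < f g" "0 < P (J s) s" using f_pos J s g by auto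
    have "P (J s) s * f (inv s \<otimes> g) \<le> c ^ J s * f g"
      using super[of "{s}" g "J s"] s g by simp
    then have "ln (P (J s) s * f (inv s \<otimes> g)) \<le> ln (c ^ J s * f g)"
      using pos c0 by (subst ln_le_cancel_iff) auto
    then show ?thesis
      using pos c0 by (simp add: u_def ln_mult ln_realpow)
  qed
  have u_mult: "u (s \<otimes> t) g = u s g + u t (inv s \<otimes> g)"
    if "s \<in> carrier G" "t \<in> carrier G" "g \<in> carrier G" for s t g
    using that by (simp add: u_def inv_mult_group m_assoc)
  have u_linf: "u s \<in> linf G" if s: "s \<in> carrier G" for s
  proof (rule linfI)
    fix g assume g: "g \<in> carrier G"
    have "u s g = - u (inv s) (inv s \<otimes> g)"
      using s g by (simp add: u_def)
    then show "\<bar>u s g\<bar> \<le> max (J s * ln c - ln (P (J s) s)) (J (inv s) * ln c - ln (P (J (inv s)) (inv s)))"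
      using u_le[OF s g] u_le[of "inv s" "inv s \<otimes> g"] s g by auto
  qed
  show "L (x \<otimes> y) = L x + L y" if x: "x \<in> carrier G" and y: "y \<in> carrier G" for x y
  proof -
    have tr: "(\<lambda>g. u y (inv x \<otimes> g)) \<in> linf G"
      using linf_translate[OF u_linf[OF y], of "inv x"] x by simp
    have "L (x \<otimes> y) = m (\<lambda>g. u x g + u y (inv x \<otimes> g))"
      unfolding L_def
      \<comment> \<open>The two functions agree only on the carrier, so equality of their means
        comes from two inequalities.\<close>
      by (intro antisym mean_mono[OF m(1)] linf_add tr u_linf) (use x y u_mult in auto)
    also have "\<dots> = L x + m (\<lambda>g. u y (inv x \<otimes> g))"
      unfolding L_def by (rule mean_add[OF m(1) u_linf[OF x] tr])
    also have "m (\<lambda>g. u y (inv x \<otimes> g)) = L y"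
      using m(2) u_linf[OF y] x unfolding translation_invariant_def L_def by simp
    finally show ?thesis .
  qed
  show "L g \<le> J g * ln c - ln (P (J g) g)" if g: "g \<in> carrier G" for g
    using mean_mono[OF m(1) u_linf[OF g] linf_const u_le[OF g]] unfolding L_def mean_const[OF m(1)] .
  show "(\<Sum>s\<in>F. \<mu> s * exp (L s)) \<le> c" if F: "finite F" "F \<subseteq> carrier G" for F
  proof -
    \<comment> \<open>The tangent bound for \<open>exp\<close> at \<open>L s\<close> makes
      superharmonicity linear in \<open>u\<close>, and \<open>F\<close> is finite because a mean is
      only finitely additive. After averaging, \<open>u s\<close> becomes \<open>L s\<close> and the
      linear terms cancel.\<close>
    have le: "(\<Sum>s\<in>F. \<mu> s * exp (L s) * (1 - L s)) + (\<Sum>s\<in>F. \<mu> s * exp (L s) * u s g) \<le> c"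
      if g: "g \<in> carrier G" for g
    proof -
      have "\<mu> s * exp (L s) * (1 - L s) + \<mu> s * exp (L s) * u s g \<le> \<mu> s * (f (inv s \<otimes> g) / f g)"
        if "s \<in> F" for s
      proof -
        have s: "s \<in> carrier G" using F that by auto
        have "exp (L s) * (1 + (u s g - L s)) \<le> exp (L s) * exp (u s g - L s)"
          by (intro mult_left_mono) auto
        also have "\<dots> = exp (u s g)" by (simp flip: exp_add)
        also have "\<dots> = f (inv s \<otimes> g) / f g"
          using f_pos s g by (simp add: u_def exp_diff)
        finally have "\<mu> s * (exp (L s) * (1 + (u s g - L s))) \<le> \<mu> s * (f (inv s \<otimes> g) / f g)"
          using mu_nonneg[OF s] by (intro mult_left_mono)
        then show ?thesis by (simp add: algebra_simps)
      qed
      then have "(\<Sum>s\<in>F. \<mu> s * exp (L s) * (1 - L s) + \<mu> s * exp (L s) * u s g)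
          \<le> (\<Sum>s\<in>F. \<mu> s * (f (inv s \<otimes> g) / f g))"
        by (rule sum_mono)
      also have "\<dots> = (\<Sum>s\<in>F. P 1 s * f (inv s \<otimes> g)) / f g"
        unfolding sum_divide_distrib using F by (intro sum.cong) (auto simp del: One_nat_def simp: P_one)
      also have "\<dots> \<le> c"
        using super[OF F g, of 1] f_pos[OF g] by (simp del: One_nat_def add: divide_le_eq)
      finally show ?thesis by (simp only: sum.distrib)
    qed
    have U: "\<And>s. s \<in> F \<Longrightarrow> u s \<in> linf G" using u_linf F by auto
    let ?S = "\<lambda>g. \<Sum>s\<in>F. \<mu> s * exp (L s) * u s g"
    have S: "?S \<in> linf G" by (rule linf_sum[OF F(1) U])
    have "m (\<lambda>g. (\<Sum>s\<in>F. \<mu> s * exp (L s) * (1 - L s)) + ?S g) \<le> m (\<lambda>g. c)"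
      using le by (intro mean_mono[OF m(1)] linf_add linf_const S)
    moreover have "m ?S = (\<Sum>s\<in>F. \<mu> s * exp (L s) * L s)"
      unfolding L_def by (rule mean_sum[OF m(1) F(1) U])
    ultimately have "(\<Sum>s\<in>F. \<mu> s * exp (L s) * (1 - L s)) + (\<Sum>s\<in>F. \<mu> s * exp (L s) * L s) \<le> c"
      unfolding mean_add[OF m(1) linf_const S] mean_const[OF m(1)] by simp
    then show ?thesis by (simp add: algebra_simps flip: sum.distrib)
  qed
qed

text \<open>Tychonoff's theorem and the finite intersection property pass from all
  \<open>c > \<Lambda>\<close> to \<open>\<Lambda>\<close> itself.\<close>

lemma exists_character:
  assumes "amenable G" and nd: "non_degenerate G \<mu>"
    and \<Lambda>: "\<And>n. P n \<one> \<le> \<Lambda> ^ n" "0 < \<Lambda>"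
  obtains L where "\<And>x y. \<lbrakk>x \<in> carrier G; y \<in> carrier G\<rbrakk> \<Longrightarrow> L (x \<otimes> y) = L x + L y"
    and "\<And>F. \<lbrakk>finite F; F \<subseteq> carrier G\<rbrakk> \<Longrightarrow> (\<Sum>s\<in>F. \<mu> s * exp (L s)) \<le> \<Lambda>"
proof -
  obtain m where m: "is_mean G m" "translation_invariant G m"
    using \<open>amenable G\<close> unfolding amenable_def by blast
  have "\<exists>n. 0 < P n g" if "g \<in> carrier G" for g
    using P_pos[OF nd that] by blast
  then obtain J where J: "\<And>g. g \<in> carrier G \<Longrightarrow> 0 < P (J g) g" by metis
  \<comment> \<open>The pointwise bound at \<open>c = \<Lambda> + 1\<close>, valid for all
    \<open>c\<close> between \<open>\<Lambda>\<close> and \<open>\<Lambda> + 1\<close>. With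
    \<open>L g = - L (inv g)\<close> it confines \<open>L g\<close> to a compact interval.\<close>
  define B where "B g = J g * ln (\<Lambda> + 1) - ln (P (J g) g)" for g
  \<comment> \<open>Fixing the value \<open>0\<close> outside the carrier makes \<open>K\<close> a
    product of compact sets over the whole type.\<close>
  define K where "K = Pi\<^sub>E UNIV (\<lambda>g. if g \<in> carrier G then {- B (inv g)..B g} else {0})"
  \<comment> \<open>Each condition involves only finitely many values of \<open>L\<close>, so
    \<open>S c\<close> is closed under pointwise convergence.\<close>
  define S where "S c = (\<Inter>x\<in>carrier G. \<Inter>y\<in>carrier G. {L. L (x \<otimes> y) = L x + L y}) \<inter>
    (\<Inter>F\<in>{F. finite F \<and> F \<subseteq> carrier G}. {L. (\<Sum>s\<in>F. \<mu> s * exp (L s)) \<le> c})" for c :: real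
  have "K \<inter> (\<Inter>c\<in>{\<Lambda><..\<Lambda> + 1}. S c) \<noteq> {}"
  proof (rule compact_imp_fip_image)
    show "compact K"
      unfolding K_def compactin_euclidean_iff[symmetric] euclidean_product_topology[symmetric]
      by (auto simp: compactin_PiE)
    show "closed (S c)" for c
      unfolding S_def
      by (intro closed_Int closed_INT ballI closed_Collect_eq closed_Collect_le continuous_intros
          continuous_on_product_coordinates)
    fix I assume I: "finite I" "I \<subseteq> {\<Lambda><..\<Lambda> + 1}"
    \<comment> \<open>\<open>S\<close> grows with \<open>c\<close>, so a homomorphism for the
      smallest index serves all of \<open>I\<close>; inserting \<open>\<Lambda> + 1\<close> covers
      empty \<open>I\<close>.\<close>
    define c where "c = Min (insert (\<Lambda> + 1) I)"
    have c: "\<Lambda> < c" "c \<le> \<Lambda> + 1" "\<And>i. i \<in> I \<Longrightarrow> c \<le> i" unfolding c_def using I by auto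
    obtain L where L: "\<And>x y. \<lbrakk>x \<in> carrier G; y \<in> carrier G\<rbrakk> \<Longrightarrow> L (x \<otimes> y) = L x + L y"
      "\<And>g. g \<in> carrier G \<Longrightarrow> L g \<le> J g * ln c - ln (P (J g) g)"
      "\<And>F. \<lbrakk>finite F; F \<subseteq> carrier G\<rbrakk> \<Longrightarrow> (\<Sum>s\<in>F. \<mu> s * exp (L s)) \<le> c"
      using exists_character_above[OF m \<Lambda> c(1) J] by blast
    define L' where "L' g = (if g \<in> carrier G then L g else 0)" for g
    have LB: "L g \<le> B g" if "g \<in> carrier G" for g
    proof -
      have "J g * ln c \<le> J g * ln (\<Lambda> + 1)"
        using c \<Lambda>(2) by (intro mult_left_mono) auto
      with L(2)[OF that] show ?thesis by (simp add: B_def)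
    qed
    have neg: "L g = - L (inv g)" if "g \<in> carrier G" for g
      using L(1)[of g "inv g"] L(1)[of \<one> \<one>] that by simp
    have "L' g \<in> (if g \<in> carrier G then {- B (inv g)..B g} else {0})" for g
      using LB[of g] LB[of "inv g"] neg[of g] by (auto simp: L'_def)
    then have "L' \<in> K" by (simp add: K_def PiE_iff)
    moreover have "L' \<in> S i" if "i \<in> I" for i
    proof -
      have "(\<Sum>s\<in>F. \<mu> s * exp (L' s)) \<le> i" if F: "finite F" "F \<subseteq> carrier G" for F
      proof -
        have "(\<Sum>s\<in>F. \<mu> s * exp (L' s)) = (\<Sum>s\<in>F. \<mu> s * exp (L s))"
          using F by (intro sum.cong) (auto simp: L'_def)
        also have "\<dots> \<le> i" using L(3)[OF F] c(3)[OF \<open>i \<in> I\<close>] by linarith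
        finally show ?thesis .
      qed
      then show ?thesis by (auto simp: S_def L'_def L(1))
    qed
    ultimately show "K \<inter> (\<Inter>c\<in>I. S c) \<noteq> {}" by blast
  qed
  then obtain L where L: "\<And>c. c \<in> {\<Lambda><..\<Lambda> + 1} \<Longrightarrow> L \<in> S c" by blast
  show ?thesis
  proof
    show "L (x \<otimes> y) = L x + L y" if "x \<in> carrier G" "y \<in> carrier G" for x y
      using L[of "\<Lambda> + 1"] that by (auto simp: S_def)
    show "(\<Sum>s\<in>F. \<mu> s * exp (L s)) \<le> \<Lambda>" if F: "finite F" "F \<subseteq> carrier G" for F
    proof (rule dense_ge_bounded)
      show "\<Lambda> < \<Lambda> + 1" by simp
      show "(\<Sum>s\<in>F. \<mu> s * exp (L s)) \<le> c" if "\<Lambda> < c" "c < \<Lambda> + 1" for c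
        using L[of c] that F by (auto simp: S_def)
    qed
  qed
qed

end

section \<open>Conclusion\<close>

text \<open>Links the extended-valued \<open>phi\<close> with real sums. A finite value bounds the
  partial sums and so forces summability, which a real \<open>infsum\<close> would not record, being
  \<open>0\<close> on non-summable functions.\<close>

lemma infsum_ennreal_eq_iff:
  fixes f :: "'a \<Rightarrow> real"
  assumes f: "\<And>x. x \<in> A \<Longrightarrow> 0 \<le> f x" and c: "0 \<le> c"
  shows "(\<Sum>\<^sub>\<infinity>x\<in>A. ennreal (f x)) = ennreal c \<longleftrightarrow> (f has_sum c) A"
proof -
  have sum: "(\<Sum>x\<in>F. ennreal (f x)) = ennreal (sum f F)" if "F \<subseteq> A" for F
    using f that by (intro sum_ennreal) auto
  have SUP: "(\<Sum>\<^sub>\<infinity>x\<in>A. ennreal (f x)) = (SUP F\<in>{F. finite F \<and> F \<subseteq> A}. ennreal (sum f F))"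
    by (subst nonneg_infsum_complete) (auto simp: sum intro!: SUP_cong)
  have eq: "(\<Sum>\<^sub>\<infinity>x\<in>A. ennreal (f x)) = ennreal (infsum f A)" if "f summable_on A"
    unfolding SUP using infsum_nonneg_is_SUPREMUM_ennreal[OF that f] by simp
  show ?thesis
  proof
    assume *: "(\<Sum>\<^sub>\<infinity>x\<in>A. ennreal (f x)) = ennreal c"
    have "sum f F \<le> c" if "finite F" "F \<subseteq> A" for F
    proof -
      have "ennreal (sum f F) \<le> ennreal c"
        unfolding *[symmetric] SUP using that by (intro SUP_upper) auto
      then show ?thesis using c by (simp add: ennreal_le_iff)
    qed
    then have "f summable_on A"
      using f by (intro nonneg_bdd_above_summable_on bdd_aboveI[of _ c]) auto
    moreover from eq[OF this] * have "infsum f A = c"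
      using c infsum_nonneg[of A f] f by (metis ennreal_inj)
    ultimately show "(f has_sum c) A" by (simp add: has_sum_iff)
  next
    assume "(f has_sum c) A"
    then show "(\<Sum>\<^sub>\<infinity>x\<in>A. ennreal (f x)) = ennreal c"
      using eq by (auto simp: has_sum_iff)
  qed
qed

theorem theorem1p3:
  fixes G :: "('a, 'b) monoid_scheme" and \<mu> :: "'a \<Rightarrow> real"
    and k :: nat and \<psi> :: "'a set set \<Rightarrow> nat \<Rightarrow> int"
  assumes "group G" and "finitely_generated_group G" and "amenable G"
    and "prob_measure_on G \<mu>" and "non_degenerate G \<mu>" and "aperiodic G \<mu>"
    and "\<psi> \<in> iso (Gbar G) (Zpow k)"
  shows "\<exists>\<xi>\<in>Rpow k.
           (\<forall>v\<in>Rpow k. spectral_radius G \<mu> = phi G k \<psi> \<mu> v \<longleftrightarrow> v = \<xi>) \<and>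
           (\<forall>g\<in>carrier G.
              (\<lambda>n. conv_pow G \<mu> n g / conv_pow G \<mu> n \<one>\<^bsub>G\<^esub>)
                \<longlonglongrightarrow> exp (- pairing k \<xi> (\<psi> (proj G g))))"
proof -
  interpret group G by fact
  interpret random_walk G \<mu> by standard fact
  note \<psi> = assms(7) and nd = assms(5)
  define \<Phi> where "\<Phi> v g = pairing k v (\<psi> (proj G g))" for v g
  have \<Phi>_mult: "\<Phi> v (x \<otimes>\<^bsub>G\<^esub> y) = \<Phi> v x + \<Phi> v y" if "x \<in> carrier G" "y \<in> carrier G" for v x y
    unfolding \<Phi>_def by (rule pairing_coords_mult[OF \<psi> that])
  obtain n0 where n0: "\<And>n. n0 \<le> n \<Longrightarrow> 0 < P n \<one>\<^bsub>G\<^esub>"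
    using assms(6) unfolding aperiodic_def by blast
  have super: "P m \<one>\<^bsub>G\<^esub> * P n \<one>\<^bsub>G\<^esub> \<le> P (m + n) \<one>\<^bsub>G\<^esub>" for m n
    using P_mult_le[of "\<one>\<^bsub>G\<^esub>" "\<one>\<^bsub>G\<^esub>" m n] by simp
  obtain \<Lambda> where \<Lambda>: "0 < \<Lambda>" "\<And>n. P n \<one>\<^bsub>G\<^esub> \<le> \<Lambda> ^ n" "(\<lambda>n. root n (P n \<one>\<^bsub>G\<^esub>)) \<longlonglongrightarrow> \<Lambda>"
    using supermultiplicative_root[of "\<lambda>n. P n \<one>\<^bsub>G\<^esub>" n0] super P_nonneg P_le_1 n0 by auto
  have "(\<lambda>n. ennreal (root n (P n \<one>\<^bsub>G\<^esub>))) \<longlonglongrightarrow> ennreal \<Lambda>"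
    using \<Lambda>(3) by (rule tendsto_ennrealI)
  then have spectral: "spectral_radius G \<mu> = ennreal \<Lambda>"
    unfolding spectral_radius_def by (rule lim_imp_Limsup[rotated]) simp
  \<comment> \<open>As \<open>\<Lambda>\<close> is finite, the equation says that the twisted
    measure has total mass \<open>\<Lambda>\<close>, which is the hypothesis of
    \<open>ratio_tendsto\<close>.\<close>
  have phi: "spectral_radius G \<mu> = phi G k \<psi> \<mu> v
      \<longleftrightarrow> ((\<lambda>g. exp (\<Phi> v g) * \<mu> g) has_sum \<Lambda>) (carrier G)" for v
    unfolding spectral phi_def \<Phi>_def
    by (subst infsum_ennreal_eq_iff[symmetric]) (use \<Lambda>(1) mu_nonneg in auto)
  have ratio: "(\<lambda>n. P n g / P n \<one>\<^bsub>G\<^esub>) \<longlonglongrightarrow> exp (- \<Phi> v g)"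
    if "spectral_radius G \<mu> = phi G k \<psi> \<mu> v" "g \<in> carrier G" for v g
    using ratio_tendsto[where L = "\<Phi> v", OF \<Phi>_mult \<Lambda>(1) _ nd n0 \<Lambda>(3)] that unfolding phi by blast
  obtain L where L: "\<And>x y. \<lbrakk>x \<in> carrier G; y \<in> carrier G\<rbrakk> \<Longrightarrow> L (x \<otimes>\<^bsub>G\<^esub> y) = L x + L y"
    and sums: "\<And>F. \<lbrakk>finite F; F \<subseteq> carrier G\<rbrakk> \<Longrightarrow> (\<Sum>s\<in>F. \<mu> s * exp (L s)) \<le> \<Lambda>"
    using exists_character[OF assms(3) nd \<Lambda>(2) \<Lambda>(1)] by blast
  obtain \<xi> where \<xi>: "\<xi> \<in> Rpow k" "\<And>g. g \<in> carrier G \<Longrightarrow> L g = \<Phi> \<xi> g"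
    using additive_eq_pairing[OF \<psi> L] unfolding \<Phi>_def by blast
  let ?f = "\<lambda>g. exp (\<Phi> \<xi> g) * \<mu> g"
  have f_nonneg: "0 \<le> ?f g" if "g \<in> carrier G" for g using mu_nonneg[OF that] by simp
  have le: "sum ?f F \<le> \<Lambda>" if "finite F" "F \<subseteq> carrier G" for F
  proof -
    have "sum ?f F = (\<Sum>s\<in>F. \<mu> s * exp (L s))"
      using that \<xi>(2) by (intro sum.cong) (auto simp: mult.commute)
    then show ?thesis using sums[OF that] by simp
  qed
  have summable: "?f summable_on carrier G"
    using f_nonneg le by (intro nonneg_bdd_above_summable_on bdd_aboveI[of _ \<Lambda>]) auto
  define c where "c = infsum ?f (carrier G)"
  have has_sum: "(?f has_sum c) (carrier G)"
    unfolding c_def using summable by simp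
  have "c \<le> \<Lambda>"
    unfolding c_def using le by (intro infsum_le_finite_sums summable)
  have "0 < c"
  proof (rule ccontr)
    assume "\<not> 0 < c"
    then have "?f g = 0" if "g \<in> carrier G" for g
      using nonneg_infsum_le_0D[OF _ summable f_nonneg that] by (simp add: c_def)
    then have "infsum \<mu> (carrier G) = 0" by (intro infsum_0) simp
    then show False using mu_sum by simp
  qed
  \<comment> \<open>The change of measure gives \<open>P n \<one> \<le> c ^ n\<close>, and taking
    roots bounds the limit.\<close>
  have "\<Lambda> \<le> c"
  proof (rule LIMSEQ_le_const2[OF \<Lambda>(3)], intro exI[of _ 1] allI impI)
    fix n :: nat assume n: "1 \<le> n"
    have "root n (P n \<one>\<^bsub>G\<^esub>) \<le> root n (c ^ n)"
      using P_one_le_power[where L = "\<Phi> \<xi>", OF \<Phi>_mult \<open>0 < c\<close> has_sum] n by (intro real_root_le_mono) auto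
    then show "root n (P n \<one>\<^bsub>G\<^esub>) \<le> c" using n \<open>0 < c\<close> by (simp add: real_root_power_cancel)
  qed
  with \<open>c \<le> \<Lambda>\<close> has_sum have \<xi>_min: "spectral_radius G \<mu> = phi G k \<psi> \<mu> \<xi>"
    unfolding phi by simp
  \<comment> \<open>The ratio limits \<open>exp (- \<Phi> v g)\<close> do not depend on the choice
    of \<open>v\<close>, so they determine the homomorphism and hence \<open>v\<close>.\<close>
  have "v = \<xi>" if v: "v \<in> Rpow k" "spectral_radius G \<mu> = phi G k \<psi> \<mu> v" for v
  proof (rule pairing_eqD[OF \<psi> v(1) \<xi>(1)])
    fix g assume "g \<in> carrier G"
    from LIMSEQ_unique[OF ratio[OF v(2) this] ratio[OF \<xi>_min this]]
    show "pairing k v (\<psi> (proj G g)) = pairing k \<xi> (\<psi> (proj G g))"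
      by (simp add: \<Phi>_def)
  qed
  with \<xi>(1) \<xi>_min ratio[OF \<xi>_min] show ?thesis
    unfolding \<Phi>_def by blast
qed

end
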